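(* The group $\mathrm{Out}(\mathcal{Q}_2)$ is not abelian.
   Context: The $2$-adic ring $C^*$-algebra $\mathcal{Q}_2$ is the universal (unital) $C^*$-algebra generated by a unitary $U$ and an isometry $S_2$ satisfying $S_2U=U^2S_2$ and $S_2S_2^*+US_2S_2^*U^*=1$. $\mathrm{Out}(\mathcal{Q}_2)$ is the quotient of $\mathrm{Aut}(\mathcal{Q}_2)$ by the normal subgroup of inner automorphisms $x\mapsto wxw^*$, with $w$ a unitary in $\mathcal{Q}_2$. *)

theory Defs
  imports "HOL-Analysis.Analysis" "HOL-Library.Poly_Mapping" "HOL-Algebra.Coset"
begin

section \<open>Unital C*-algebras\<close>

class scaleC =
  fixes scaleC :: "complex \<Rightarrow> 'a \<Rightarrow> 'a"  (infixr \<open>*\<^sub>C\<close> 75)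

class star =
  fixes star :: "'a \<Rightarrow> 'a"

class complex_star_algebra = scaleC + star + ring + monoid_mult +
  assumes scaleC_add_right: "c *\<^sub>C (x + y) = c *\<^sub>C x + c *\<^sub>C y"
    and scaleC_add_left: "(c + d) *\<^sub>C x = c *\<^sub>C x + d *\<^sub>C x"
    and scaleC_scaleC: "c *\<^sub>C d *\<^sub>C x = (c * d) *\<^sub>C x"
    and scaleC_one: "1 *\<^sub>C x = x"
    and mult_scaleC_left: "(c *\<^sub>C x) * y = c *\<^sub>C (x * y)"
    and mult_scaleC_right: "x * (c *\<^sub>C y) = c *\<^sub>C (x * y)"
    and star_add: "star (x + y) = star x + star y"
    and star_scaleC: "star (c *\<^sub>C x) = cnj c *\<^sub>C star x"
    and star_mult: "star (x * y) = star y * star x"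
    and star_star: "star (star x) = x"

text \<open>The zero algebra is admitted: neither \<open>0 \<noteq> 1\<close> nor \<open>norm 1 = 1\<close> is required.\<close>

class cstar_algebra = complex_star_algebra + real_normed_algebra + banach +
  assumes scaleR_scaleC: "r *\<^sub>R x = of_real r *\<^sub>C x"
    and norm_scaleC: "norm (c *\<^sub>C x) = cmod c * norm x"
    and cstar_identity: "norm (star x * x) = (norm x)\<^sup>2"

definition star_hom :: "('a::cstar_algebra \<Rightarrow> 'b::cstar_algebra) \<Rightarrow> bool" where
  "star_hom \<phi> \<longleftrightarrow>
     (\<forall>x y. \<phi> (x + y) = \<phi> x + \<phi> y) \<and>
     (\<forall>c x. \<phi> (c *\<^sub>C x) = c *\<^sub>C \<phi> x) \<and>
     (\<forall>x y. \<phi> (x * y) = \<phi> x * \<phi> y) \<and>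
     (\<forall>x. \<phi> (star x) = star (\<phi> x)) \<and>
     \<phi> 1 = 1"

definition isometry_elt :: "'a::cstar_algebra \<Rightarrow> bool" where
  "isometry_elt s \<longleftrightarrow> star s * s = 1"

definition unitary_elt :: "'a::cstar_algebra \<Rightarrow> bool" where
  "unitary_elt u \<longleftrightarrow> star u * u = 1 \<and> u * star u = 1"


section \<open>Automorphisms, inner automorphisms and outer automorphisms\<close>

definition Aut :: "('a::cstar_algebra \<Rightarrow> 'a) monoid" where
  "Aut = \<lparr>carrier = {\<phi>. star_hom \<phi> \<and> bij \<phi>}, mult = (\<circ>), one = id\<rparr>"

definition Inn :: "('a::cstar_algebra \<Rightarrow> 'a) set" where
  "Inn = {\<lambda>x. w * x * star w | w. unitary_elt w}"

definition Out :: "('a::cstar_algebra \<Rightarrow> 'a) set monoid" where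
  "Out = Aut Mod Inn"

lemma star_one: "star (1::'a::complex_star_algebra) = 1"
proof -
  have "star 1 = star (1::'a) * star (star 1)"
    by (simp add: star_star)
  also have "\<dots> = star (star 1 * 1)"
    by (simp only: star_mult)
  also have "\<dots> = 1"
    by (simp add: star_star)
  finally show ?thesis .
qed

lemma star_hom_id: "star_hom id"
  by (simp add: star_hom_def)

lemma star_hom_comp: "star_hom \<phi> \<Longrightarrow> star_hom \<psi> \<Longrightarrow> star_hom (\<phi> \<circ> \<psi>)"
  by (simp add: star_hom_def)

lemma star_hom_inv_into:
  assumes "star_hom \<phi>" "bij \<phi>"
  shows "star_hom (inv_into UNIV \<phi>)"
proof -
  have i: "inv_into UNIV \<phi> y = x \<longleftrightarrow> y = \<phi> x" for x y
    using assms(2) by (metis bij_inv_eq_iff)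
  have r: "\<phi> (inv_into UNIV \<phi> y) = y" for y
    using assms(2) by (simp add: bij_is_surj surj_f_inv_f)
  show ?thesis
    using assms(1) unfolding star_hom_def i by (simp add: r)
qed

lemma unitary_elt_one: "unitary_elt 1"
  by (simp add: unitary_elt_def star_one)

lemma unitary_elt_star: "unitary_elt w \<Longrightarrow> unitary_elt (star w)"
  by (simp add: unitary_elt_def star_star)

lemma unitary_elt_mult:
  assumes "unitary_elt v" "unitary_elt w"
  shows "unitary_elt (v * w)"
proof -
  have "star v * (v * z) = z" "w * (star w * z) = z" for z
    using assms by (simp_all add: unitary_elt_def flip: mult.assoc)
  then show ?thesis
    using assms by (simp add: unitary_elt_def star_mult mult.assoc)
qed

lemma star_hom_unitary_elt: "star_hom \<phi> \<Longrightarrow> unitary_elt w \<Longrightarrow> unitary_elt (\<phi> w)"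
  unfolding star_hom_def unitary_elt_def by metis

lemma group_Aut: "group (Aut :: ('a::cstar_algebra \<Rightarrow> 'a) monoid)"
proof (rule groupI)
  fix \<phi> :: "'a \<Rightarrow> 'a" assume "\<phi> \<in> carrier Aut"
  then have p: "star_hom \<phi>" "bij \<phi>"
    by (auto simp: Aut_def)
  have "inv_into UNIV \<phi> \<in> carrier Aut"
    using p by (simp add: Aut_def star_hom_inv_into bij_imp_bij_inv)
  moreover have "inv_into UNIV \<phi> \<circ> \<phi> = id"
    using p(2) by (simp add: bij_is_inj)
  ultimately show "\<exists>\<psi>\<in>carrier Aut. \<psi> \<otimes>\<^bsub>Aut\<^esub> \<phi> = \<one>\<^bsub>Aut\<^esub>"
    by (auto simp: Aut_def)
qed (auto simp: Aut_def star_hom_comp bij_comp star_hom_id o_assoc)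

lemma Inn_subset_Aut: "Inn \<subseteq> carrier (Aut :: ('a::cstar_algebra \<Rightarrow> 'a) monoid)"
proof
  fix \<phi> :: "'a \<Rightarrow> 'a" assume "\<phi> \<in> Inn"
  then obtain w where w: "unitary_elt w" "\<phi> = (\<lambda>x. w * x * star w)"
    by (auto simp: Inn_def)
  have w': "star w * w = 1" "w * star w = 1"
    using w(1) by (auto simp: unitary_elt_def)
  have c: "star w * (w * z) = z" "w * (star w * z) = z" for z
    using w' by (simp_all flip: mult.assoc)
  have "star_hom \<phi>"
    by (simp add: star_hom_def w(2) distrib_left distrib_right mult_scaleC_left mult_scaleC_right
        star_mult star_star mult.assoc c w')
  moreover have "bij \<phi>"
    by (rule o_bij [where g = "\<lambda>x. star w * x * w"]) (auto simp: fun_eq_iff w(2) mult.assoc c w')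
  ultimately show "\<phi> \<in> carrier Aut"
    by (simp add: Aut_def)
qed

lemma normal_Inn: "Inn \<lhd> (Aut :: ('a::cstar_algebra \<Rightarrow> 'a) monoid)"
proof -
  interpret group "Aut :: ('a \<Rightarrow> 'a) monoid"
    by (rule group_Aut)
  have comp: "(\<lambda>x. v * x * star v) \<circ> (\<lambda>x. w * x * star w) = (\<lambda>x. (v * w) * x * star (v * w))"
    for v w :: 'a
    by (simp add: fun_eq_iff star_mult mult.assoc)
  have id1: "(\<lambda>x::'a. 1 * x * star 1) = id"
    by (simp add: fun_eq_iff star_one)
  have sub: "subgroup (Inn :: ('a \<Rightarrow> 'a) set) Aut"
  proof (rule subgroupI [OF Inn_subset_Aut])
    show "(Inn :: ('a \<Rightarrow> 'a) set) \<noteq> {}"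
      using unitary_elt_one by (auto simp: Inn_def)
  next
    fix \<phi> :: "'a \<Rightarrow> 'a" assume \<phi>: "\<phi> \<in> Inn"
    then obtain w where w: "unitary_elt w" "\<phi> = (\<lambda>x. w * x * star w)"
      by (auto simp: Inn_def)
    let ?\<psi> = "\<lambda>x. star w * x * star (star w)"
    have \<psi>: "?\<psi> \<in> Inn"
      using unitary_elt_star [OF w(1)] by (auto simp: Inn_def)
    have "?\<psi> \<circ> \<phi> = id"
      using w(1) by (simp only: w(2) comp) (simp add: unitary_elt_def star_one fun_eq_iff)
    then have "inv\<^bsub>Aut\<^esub> \<phi> = ?\<psi>"
      using Inn_subset_Aut \<phi> \<psi> by (intro inv_equality) (auto simp: Aut_def)
    with \<psi> show "inv\<^bsub>Aut\<^esub> \<phi> \<in> Inn"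
      by simp
  next
    fix \<phi> \<psi> :: "'a \<Rightarrow> 'a" assume "\<phi> \<in> Inn" "\<psi> \<in> Inn"
    then obtain v w where "unitary_elt v" "\<phi> = (\<lambda>x. v * x * star v)"
        "unitary_elt w" "\<psi> = (\<lambda>x. w * x * star w)"
      by (auto simp: Inn_def)
    then have "\<phi> \<circ> \<psi> \<in> Inn"
      using unitary_elt_mult [of v w] comp [of v w] by (auto simp: Inn_def)
    then show "\<phi> \<otimes>\<^bsub>Aut\<^esub> \<psi> \<in> Inn"
      by (simp add: Aut_def)
  qed
  show ?thesis
    unfolding normal_inv_iff
  proof (intro conjI sub ballI)
    fix \<phi> \<psi> :: "'a \<Rightarrow> 'a" assume \<phi>: "\<phi> \<in> carrier Aut" and "\<psi> \<in> Inn"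
    then obtain w where w: "unitary_elt w" "\<psi> = (\<lambda>x. w * x * star w)"
      by (auto simp: Inn_def)
    have h: "star_hom \<phi>" "bij \<phi>"
      using \<phi> by (auto simp: Aut_def)
    let ?\<phi>' = "inv\<^bsub>Aut\<^esub> \<phi>"
    have c: "\<phi> (?\<phi>' x) = x" for x
      using r_inv [OF \<phi>] by (simp add: Aut_def fun_eq_iff)
    have "\<phi> \<circ> \<psi> \<circ> ?\<phi>' = (\<lambda>x. \<phi> w * x * star (\<phi> w))"
      using h(1) by (simp add: fun_eq_iff w(2) star_hom_def c)
    moreover have "(\<lambda>x. \<phi> w * x * star (\<phi> w)) \<in> Inn"
      using star_hom_unitary_elt [OF h(1) w(1)] by (auto simp: Inn_def)
    ultimately show "\<phi> \<otimes>\<^bsub>Aut\<^esub> \<psi> \<otimes>\<^bsub>Aut\<^esub> ?\<phi>' \<in> Inn"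
      by (simp add: Aut_def)
  qed
qed

lemma group_Out: "group (Out :: ('a::cstar_algebra \<Rightarrow> 'a) set monoid)"
  unfolding Out_def by (rule normal.factorgroup_is_group [OF normal_Inn])


section \<open>The free unital *-algebra on two generators\<close>

text \<open>\<open>LUs\<close> and \<open>LSs\<close> stand for the formal adjoints of \<open>LU\<close> and \<open>LS\<close>. Words are written additively
  because \<open>poly_mapping\<close> forms the monoid algebra of an additive (not necessarily commutative)
  monoid.\<close>

datatype q2_letter = LU | LUs | LS | LSs

datatype q2_word = Word (letters: "q2_letter list")

instantiation q2_word :: monoid_add
begin

definition "0 = Word []"
definition "v + w = Word (letters v @ letters w)"

instance
  by standard (auto simp: zero_q2_word_def plus_q2_word_def)

end

type_synonym q2_free = "q2_word \<Rightarrow>\<^sub>0 complex"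

fun letter_star :: "q2_letter \<Rightarrow> q2_letter" where
  "letter_star LU = LUs"
| "letter_star LUs = LU"
| "letter_star LS = LSs"
| "letter_star LSs = LS"

definition word_star :: "q2_word \<Rightarrow> q2_word" where
  "word_star w = Word (rev (map letter_star (letters w)))"

lemma letter_star_letter_star [simp]: "letter_star (letter_star l) = l"
  by (cases l) auto

lemma word_star_word_star [simp]: "word_star (word_star w) = w"
  by (cases w) (simp add: word_star_def rev_map o_def)

lemma word_star_zero [simp]: "word_star 0 = 0"
  by (simp add: word_star_def zero_q2_word_def)

lemma word_star_add: "word_star (v + w) = word_star w + word_star v"
  by (simp add: word_star_def plus_q2_word_def)

definition free_scale :: "complex \<Rightarrow> q2_free \<Rightarrow> q2_free" where
  "free_scale c a = Poly_Mapping.single 0 c * a"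

lift_definition free_star :: "q2_free \<Rightarrow> q2_free" is "\<lambda>a w. cnj (a (word_star w))"
proof -
  fix a :: "q2_word \<Rightarrow> complex" assume "finite {w. a w \<noteq> 0}"
  then have "finite (word_star ` {w. a w \<noteq> 0})"
    by simp
  then show "finite {w. cnj (a (word_star w)) \<noteq> 0}"
    by (rule finite_subset [rotated]) (auto intro!: image_eqI [where x = "word_star _"])
qed

definition free_U :: q2_free where "free_U = Poly_Mapping.single (Word [LU]) 1"
definition free_S :: q2_free where "free_S = Poly_Mapping.single (Word [LS]) 1"

lemma free_induct [case_names zero single add]:
  fixes a :: q2_free
  assumes 0: "P 0" and s: "\<And>w c. P (Poly_Mapping.single w c)"
    and a: "\<And>a b. P a \<Longrightarrow> P b \<Longrightarrow> P (a + b)"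
  shows "P a"
proof (induction a rule: Poly_Mapping.update_induct)
  case const
  show ?case by (rule 0)
next
  case (update f w c)
  have "Poly_Mapping.update w c f = Poly_Mapping.single w c + f"
    using update(1)
    by (intro poly_mapping_eqI) (auto simp: lookup_update lookup_add lookup_single in_keys_iff when_def)
  then show ?case
    using a s update by simp
qed

lemma free_star_single: "free_star (Poly_Mapping.single w c) = Poly_Mapping.single (word_star w) (cnj c)"
  by (intro poly_mapping_eqI) (auto simp: free_star.rep_eq lookup_single when_def)

lemma free_star_add: "free_star (a + b) = free_star a + free_star b"
  by (intro poly_mapping_eqI) (simp add: free_star.rep_eq lookup_add)

lemma free_star_zero [simp]: "free_star 0 = 0"
  by (intro poly_mapping_eqI) (simp add: free_star.rep_eq)

lemma free_star_uminus: "free_star (- a) = - free_star a"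
  by (intro poly_mapping_eqI) (simp add: free_star.rep_eq)

lemma free_star_diff: "free_star (a - b) = free_star a - free_star b"
  by (intro poly_mapping_eqI) (simp add: free_star.rep_eq lookup_minus)

lemma free_star_star: "free_star (free_star a) = a"
  by (intro poly_mapping_eqI) (simp add: free_star.rep_eq)

lemma free_star_mult: "free_star (a * b) = free_star b * free_star a"
proof (induction a rule: free_induct)
  case (single v c)
  show ?case
    by (induction b rule: free_induct)
      (simp_all add: free_star_single mult_single word_star_add mult.commute distrib_left
        distrib_right free_star_add)
qed (simp_all add: distrib_left distrib_right free_star_add)

lemma single_zero_central: "Poly_Mapping.single 0 c * a = a * (Poly_Mapping.single 0 c :: q2_free)"
  by (induction a rule: free_induct) (simp_all add: mult_single distrib_left distrib_right mult.commute)

lemma free_star_one [simp]: "free_star 1 = 1"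
  using free_star_single [of 0 1] by simp

lemma free_scale_star: "free_star (free_scale c a) = free_scale (cnj c) (free_star a)"
  by (simp add: free_scale_def free_star_mult free_star_single single_zero_central)


section \<open>The universal C*-seminorm\<close>

definition cstar_seminorm :: "(q2_free \<Rightarrow> real) \<Rightarrow> bool" where
  "cstar_seminorm p \<longleftrightarrow>
     (\<forall>a b. p (a + b) \<le> p a + p b) \<and>
     (\<forall>c a. p (free_scale c a) = cmod c * p a) \<and>
     (\<forall>a b. p (a * b) \<le> p a * p b) \<and>
     (\<forall>a. p (free_star a * a) = (p a)\<^sup>2)"

definition q2_relators :: "q2_free set" where
  "q2_relators =
     {free_star free_U * free_U - 1,
      free_U * free_star free_U - 1,
      free_star free_S * free_S - 1,
      free_S * free_U - free_U\<^sup>2 * free_S,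
      free_S * free_star free_S + free_U * free_S * free_star free_S * free_star free_U - 1}"

text \<open>The C*-seminorms vanishing on the relators are exactly the functions
  \<open>a \<mapsto> \<parallel>\<pi> a\<parallel>\<close> for unital *-homomorphisms \<open>\<pi>\<close> from the free *-algebra to C*-algebras in which the
  relations hold, so their supremum is the norm of the universal C*-algebra. Indexing the
  supremum by the seminorms themselves avoids quantifying over all C*-algebras.\<close>

definition q2_seminorms :: "(q2_free \<Rightarrow> real) set" where
  "q2_seminorms = {p. cstar_seminorm p \<and> (\<forall>r\<in>q2_relators. p r = 0)}"

definition q2_unorm :: "q2_free \<Rightarrow> real" where
  "q2_unorm a = (SUP p\<in>q2_seminorms. p a)"

lemma q2_seminorms_nonempty: "q2_seminorms \<noteq> {}"
proof -
  have "(\<lambda>_. 0) \<in> q2_seminorms"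
    by (simp add: q2_seminorms_def cstar_seminorm_def)
  then show ?thesis by auto
qed

lemma free_scale_neg_one: "free_scale (- 1) a = - a"
  by (simp add: free_scale_def single_uminus)

lemma free_scale_zero: "free_scale 0 a = 0"
  by (simp add: free_scale_def)

context
  fixes p assumes p: "p \<in> q2_seminorms"
begin

lemma sn_add: "p (a + b) \<le> p a + p b"
  and sn_scale: "p (free_scale c a) = cmod c * p a"
  and sn_mult: "p (a * b) \<le> p a * p b"
  and sn_cstar: "p (free_star a * a) = (p a)\<^sup>2"
  and sn_relator: "r \<in> q2_relators \<Longrightarrow> p r = 0"
  using p by (auto simp: q2_seminorms_def cstar_seminorm_def)

lemma sn_zero: "p 0 = 0"
  using sn_scale [of 0 0] by (simp add: free_scale_zero)

lemma sn_uminus: "p (- a) = p a"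
  using sn_scale [of "-1" a] by (simp add: free_scale_neg_one)

lemma sn_nonneg: "0 \<le> p a"
  using sn_add [of a "- a"] by (simp add: sn_zero sn_uminus)

lemma sn_star: "p (free_star a) = p a"
proof -
  have *: "p b \<le> p (free_star b)" for b
  proof (cases "p b = 0")
    case False
    then have "p b > 0"
      using sn_nonneg [of b] by simp
    moreover have "p b * p b \<le> p (free_star b) * p b"
      using sn_mult [of "free_star b" b] by (simp add: sn_cstar power2_eq_square)
    ultimately show ?thesis
      by (simp add: mult_le_cancel_right)
  qed (simp add: sn_nonneg)
  show ?thesis
    using * [of a] * [of "free_star a"] by (simp add: free_star_star)
qed

lemma sn_one: "p 1 \<le> 1"
  using sn_cstar [of 1] by (auto simp: power2_eq_square)

lemma sn_isometry:
  assumes "free_star a * a - 1 \<in> q2_relators"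
  shows "p a \<le> 1"
proof -
  have "(p a)\<^sup>2 \<le> p (free_star a * a - 1) + p 1"
    using sn_add [of "free_star a * a - 1" 1] by (simp add: sn_cstar)
  also have "\<dots> \<le> 1"
    using sn_relator [OF assms] sn_one by simp
  finally show ?thesis
    using sn_nonneg [of a] by (simp add: power_le_one_iff)
qed

lemma sn_letter: "p (Poly_Mapping.single (Word [l]) 1) \<le> 1"
proof -
  have "p free_U \<le> 1" "p free_S \<le> 1"
    by (rule sn_isometry, simp add: q2_relators_def)+
  then show ?thesis
    using sn_star [of free_U] sn_star [of free_S]
    by (cases l) (auto simp: free_U_def free_S_def free_star_single word_star_def)
qed

lemma sn_word: "p (Poly_Mapping.single (Word ls) 1) \<le> 1"
proof (induction ls)
  case Nil
  show ?case
    using sn_one by (simp flip: zero_q2_word_def)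
next
  case (Cons l ls)
  have "Poly_Mapping.single (Word (l # ls)) (1::complex) =
      Poly_Mapping.single (Word [l]) 1 * Poly_Mapping.single (Word ls) 1"
    by (simp add: mult_single plus_q2_word_def)
  then have "p (Poly_Mapping.single (Word (l # ls)) 1) \<le>
      p (Poly_Mapping.single (Word [l]) 1) * p (Poly_Mapping.single (Word ls) 1)"
    using sn_mult by simp
  also have "\<dots> \<le> 1 * 1"
    using Cons sn_letter sn_nonneg by (intro mult_mono) auto
  finally show ?case by simp
qed

lemma sn_single: "p (Poly_Mapping.single w c) \<le> cmod c"
proof -
  have "Poly_Mapping.single w c = free_scale c (Poly_Mapping.single w 1)"
    by (simp add: free_scale_def mult_single)
  then show ?thesis
    using sn_word [of "letters w"] by (simp add: sn_scale mult_left_le)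
qed

end

lemma sn_bounded: "\<exists>M. \<forall>p\<in>q2_seminorms. p a \<le> M"
proof (induction a rule: free_induct)
  case zero
  show ?case
    by (intro exI [of _ 0]) (simp add: sn_zero)
next
  case (single w c)
  then show ?case
    using sn_single by blast
next
  case (add a b)
  then obtain M N where "\<forall>p\<in>q2_seminorms. p a \<le> M" "\<forall>p\<in>q2_seminorms. p b \<le> N"
    by blast
  then have "\<forall>p\<in>q2_seminorms. p (a + b) \<le> M + N"
    using sn_add by (smt (verit))
  then show ?case ..
qed

lemma sn_le_unorm: "p \<in> q2_seminorms \<Longrightarrow> p a \<le> q2_unorm a"
  unfolding q2_unorm_def using sn_bounded [of a]
  by (intro cSUP_upper) (auto simp: bdd_above_def)

lemma unorm_least: "(\<And>p. p \<in> q2_seminorms \<Longrightarrow> p a \<le> M) \<Longrightarrow> q2_unorm a \<le> M"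
  unfolding q2_unorm_def by (intro cSUP_least q2_seminorms_nonempty)

lemma unorm_nonneg: "0 \<le> q2_unorm a"
  using q2_seminorms_nonempty sn_nonneg sn_le_unorm by (metis all_not_in_conv order_trans)

lemma unorm_in_q2_seminorms: "q2_unorm \<in> q2_seminorms"
  unfolding q2_seminorms_def cstar_seminorm_def
proof (intro CollectI conjI allI ballI)
  fix a b
  show "q2_unorm (a + b) \<le> q2_unorm a + q2_unorm b"
    by (rule unorm_least) (meson add_mono order_trans sn_add sn_le_unorm)
  show "q2_unorm (a * b) \<le> q2_unorm a * q2_unorm b"
    by (rule unorm_least)
      (meson mult_mono order_trans sn_mult sn_le_unorm sn_nonneg unorm_nonneg)
next
  fix c a
  show "q2_unorm (free_scale c a) = cmod c * q2_unorm a"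
  proof (rule antisym)
    show "q2_unorm (free_scale c a) \<le> cmod c * q2_unorm a"
      by (rule unorm_least) (simp add: sn_scale mult_left_mono sn_le_unorm)
    show "cmod c * q2_unorm a \<le> q2_unorm (free_scale c a)"
    proof (cases "c = 0")
      case False
      have "q2_unorm a \<le> q2_unorm (free_scale c a) / cmod c"
      proof (rule unorm_least)
        fix p assume "p \<in> q2_seminorms"
        then show "p a \<le> q2_unorm (free_scale c a) / cmod c"
          using False sn_le_unorm [of p "free_scale c a"] by (simp add: sn_scale field_simps)
      qed
      then show ?thesis
        using False by (simp add: field_simps)
    qed (simp add: unorm_nonneg)
  qed
next
  fix a
  show "q2_unorm (free_star a * a) = (q2_unorm a)\<^sup>2"
  proof (rule antisym)
    show "q2_unorm (free_star a * a) \<le> (q2_unorm a)\<^sup>2"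
      by (rule unorm_least) (simp add: sn_cstar power_mono sn_le_unorm sn_nonneg)
    have "q2_unorm a \<le> sqrt (q2_unorm (free_star a * a))"
      by (rule unorm_least) (metis real_le_rsqrt sn_cstar sn_le_unorm)
    then have "(q2_unorm a)\<^sup>2 \<le> (sqrt (q2_unorm (free_star a * a)))\<^sup>2"
      using unorm_nonneg by (intro power_mono)
    then show "(q2_unorm a)\<^sup>2 \<le> q2_unorm (free_star a * a)"
      by (simp add: unorm_nonneg)
  qed
next
  fix r assume "r \<in> q2_relators"
  then have "q2_unorm r \<le> 0"
    by (intro unorm_least) (simp add: sn_relator)
  then show "q2_unorm r = 0"
    using unorm_nonneg by (simp add: antisym)
qed

lemmas unorm_add = sn_add [OF unorm_in_q2_seminorms]
  and unorm_scale = sn_scale [OF unorm_in_q2_seminorms]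
  and unorm_mult = sn_mult [OF unorm_in_q2_seminorms]
  and unorm_cstar = sn_cstar [OF unorm_in_q2_seminorms]
  and unorm_relator = sn_relator [OF unorm_in_q2_seminorms]
  and unorm_zero = sn_zero [OF unorm_in_q2_seminorms]
  and unorm_uminus = sn_uminus [OF unorm_in_q2_seminorms]
  and unorm_star = sn_star [OF unorm_in_q2_seminorms]

lemma unorm_diff_commute: "q2_unorm (a - b) = q2_unorm (b - a)"
  by (metis minus_diff_eq unorm_uminus)

lemma unorm_diff_triangle: "q2_unorm (a - c) \<le> q2_unorm (a - b) + q2_unorm (b - c)"
  using unorm_add [of "a - b" "b - c"] by simp

lemma unorm_rev_triangle: "\<bar>q2_unorm a - q2_unorm b\<bar> \<le> q2_unorm (a - b)"
  using unorm_add [of "a - b" b] unorm_add [of "b - a" a] unorm_diff_commute [of a b] by simp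


section \<open>The 2-adic ring C*-algebra\<close>

text \<open>The Hausdorff completion of the free *-algebra with respect to \<open>q2_unorm\<close>: Cauchy sequences
  modulo null sequences.\<close>

definition q2_cauchy :: "(nat \<Rightarrow> q2_free) \<Rightarrow> bool" where
  "q2_cauchy X \<longleftrightarrow> (\<forall>e>0. \<exists>N. \<forall>m\<ge>N. \<forall>n\<ge>N. q2_unorm (X m - X n) < e)"

definition q2_rel :: "(nat \<Rightarrow> q2_free) \<Rightarrow> (nat \<Rightarrow> q2_free) \<Rightarrow> bool" where
  "q2_rel X Y \<longleftrightarrow> q2_cauchy X \<and> q2_cauchy Y \<and> (\<lambda>n. q2_unorm (X n - Y n)) \<longlonglongrightarrow> 0"

lemma q2_cauchy_iff:
  "q2_cauchy X \<longleftrightarrow> ((\<lambda>(m, n). q2_unorm (X m - X n)) \<longlongrightarrow> 0) (sequentially \<times>\<^sub>F sequentially)"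
  unfolding q2_cauchy_def tendsto_iff eventually_prod_sequentially
  by (simp add: dist_real_def unorm_nonneg) (metis unorm_diff_commute)

lemma q2_cauchyI:
  assumes "(g \<longlongrightarrow> 0) (sequentially \<times>\<^sub>F sequentially)"
    and "\<And>m n. q2_unorm (X m - X n) \<le> g (m, n)"
  shows "q2_cauchy X"
  unfolding q2_cauchy_iff
  by (rule Lim_null_comparison [OF _ assms(1)]) (auto simp: unorm_nonneg assms(2) intro!: always_eventually)

lemma unorm_null_comparison:
  assumes "g \<longlonglongrightarrow> 0" "\<And>n. q2_unorm (f n) \<le> g n"
  shows "(\<lambda>n. q2_unorm (f n)) \<longlonglongrightarrow> 0"
  by (rule Lim_null_comparison [OF _ assms(1)]) (auto simp: unorm_nonneg assms(2) intro!: always_eventually)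

lemma q2_cauchy_const [simp]: "q2_cauchy (\<lambda>_. a)"
  by (simp add: q2_cauchy_def unorm_zero)

lemma q2_cauchy_add:
  assumes "q2_cauchy X" "q2_cauchy Y"
  shows "q2_cauchy (\<lambda>n. X n + Y n)"
proof (rule q2_cauchyI)
  show "((\<lambda>z. (\<lambda>(m, n). q2_unorm (X m - X n)) z + (\<lambda>(m, n). q2_unorm (Y m - Y n)) z) \<longlongrightarrow> 0)
      (sequentially \<times>\<^sub>F sequentially)"
    using assms by (auto simp: q2_cauchy_iff intro!: tendsto_add_zero)
  show "q2_unorm (X m + Y m - (X n + Y n)) \<le>
      (\<lambda>(m, n). q2_unorm (X m - X n)) (m, n) + (\<lambda>(m, n). q2_unorm (Y m - Y n)) (m, n)" for m n
    using unorm_add [of "X m - X n" "Y m - Y n"] by (simp add: add_diff_add)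
qed

lemma free_scale_diff: "free_scale c a - free_scale c b = free_scale c (a - b)"
  by (simp add: free_scale_def right_diff_distrib)

lemma q2_cauchy_scale:
  assumes "q2_cauchy X"
  shows "q2_cauchy (\<lambda>n. free_scale c (X n))"
proof (rule q2_cauchyI)
  show "((\<lambda>z. cmod c * (\<lambda>(m, n). q2_unorm (X m - X n)) z) \<longlongrightarrow> 0) (sequentially \<times>\<^sub>F sequentially)"
    using assms by (auto simp: q2_cauchy_iff intro!: tendsto_mult_right_zero)
qed (simp add: free_scale_diff unorm_scale)

lemma q2_cauchy_uminus: "q2_cauchy X \<Longrightarrow> q2_cauchy (\<lambda>n. - X n)"
  using q2_cauchy_scale [of X "-1"] by (simp add: free_scale_neg_one)

lemma q2_cauchy_diff: "q2_cauchy X \<Longrightarrow> q2_cauchy Y \<Longrightarrow> q2_cauchy (\<lambda>n. X n - Y n)"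
  using q2_cauchy_add [OF _ q2_cauchy_uminus, of X Y] by simp

lemma q2_cauchy_star: "q2_cauchy X \<Longrightarrow> q2_cauchy (\<lambda>n. free_star (X n))"
  by (simp add: q2_cauchy_def unorm_star flip: free_star_diff)

lemma q2_cauchy_unorm:
  assumes "q2_cauchy X"
  shows "Cauchy (\<lambda>n. q2_unorm (X n))"
proof (rule metric_CauchyI)
  fix e :: real assume "e > 0"
  with assms obtain N where "\<forall>m\<ge>N. \<forall>n\<ge>N. q2_unorm (X m - X n) < e"
    by (auto simp: q2_cauchy_def)
  then show "\<exists>N. \<forall>m\<ge>N. \<forall>n\<ge>N. dist (q2_unorm (X m)) (q2_unorm (X n)) < e"
    unfolding dist_real_def by (meson le_less_trans unorm_rev_triangle)
qed

lemma q2_cauchy_bounded: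
  assumes "q2_cauchy X"
  obtains M where "\<And>n. q2_unorm (X n) \<le> M"
  using Cauchy_Bseq [OF q2_cauchy_unorm [OF assms]]
  by (auto simp: Bseq_def unorm_nonneg)

lemma unorm_mult_diff:
  assumes "q2_unorm b \<le> N" "q2_unorm a' \<le> M"
  shows "q2_unorm (a * b - a' * b') \<le> q2_unorm (a - a') * N + M * q2_unorm (b - b')"
proof -
  have "a * b - a' * b' = (a - a') * b + a' * (b - b')"
    by (simp add: algebra_simps)
  then have "q2_unorm (a * b - a' * b') \<le> q2_unorm ((a - a') * b) + q2_unorm (a' * (b - b'))"
    using unorm_add by simp
  also have "\<dots> \<le> q2_unorm (a - a') * q2_unorm b + q2_unorm a' * q2_unorm (b - b')"
    by (intro add_mono unorm_mult)
  also have "\<dots> \<le> q2_unorm (a - a') * N + M * q2_unorm (b - b')"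
    using assms by (intro add_mono mult_left_mono mult_right_mono unorm_nonneg)
  finally show ?thesis .
qed

lemma q2_cauchy_mult:
  assumes "q2_cauchy X" "q2_cauchy Y"
  shows "q2_cauchy (\<lambda>n. X n * Y n)"
proof -
  obtain M N where M: "\<And>n. q2_unorm (X n) \<le> M" and N: "\<And>n. q2_unorm (Y n) \<le> N"
    using assms q2_cauchy_bounded by metis
  show ?thesis
  proof (rule q2_cauchyI)
    show "((\<lambda>z. (\<lambda>(m, n). q2_unorm (X m - X n)) z * N + M * (\<lambda>(m, n). q2_unorm (Y m - Y n)) z)
        \<longlongrightarrow> 0) (sequentially \<times>\<^sub>F sequentially)"
      using assms
      by (auto simp: q2_cauchy_iff intro!: tendsto_add_zero tendsto_mult_left_zero tendsto_mult_right_zero)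
  qed (use unorm_mult_diff [OF N M] in simp)
qed

lemma part_equivp_q2_rel: "part_equivp q2_rel"
proof (rule part_equivpI)
  show "\<exists>X. q2_rel X X"
    by (rule exI [of _ "\<lambda>_. 0"]) (simp add: q2_rel_def unorm_zero)
  show "symp q2_rel"
    by (auto simp: symp_def q2_rel_def unorm_diff_commute)
  show "transp q2_rel"
  proof (rule transpI)
    fix X Y Z assume *: "q2_rel X Y" "q2_rel Y Z"
    then have "(\<lambda>n. q2_unorm (X n - Y n) + q2_unorm (Y n - Z n)) \<longlonglongrightarrow> 0"
      by (auto simp: q2_rel_def intro: tendsto_add_zero)
    then have "(\<lambda>n. q2_unorm (X n - Z n)) \<longlonglongrightarrow> 0"
      by (rule unorm_null_comparison) (rule unorm_diff_triangle)
    with * show "q2_rel X Z"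
      by (simp add: q2_rel_def)
  qed
qed

quotient_type Q2 = "nat \<Rightarrow> q2_free" / partial: q2_rel
  morphisms rep_Q2 Abs_Q2
  by (rule part_equivp_q2_rel)

lemma q2_rel_refl_iff: "q2_rel X X \<longleftrightarrow> q2_cauchy X"
  by (auto simp: q2_rel_def unorm_zero)

lemma Q2_induct [case_names Abs, induct type: Q2]:
  assumes "\<And>X. q2_cauchy X \<Longrightarrow> P (Abs_Q2 X)"
  shows "P x"
  using assms Quotient3_Q2 by (metis Quotient3_def q2_rel_refl_iff)

lemma Abs_Q2_eq_iff: "q2_cauchy X \<Longrightarrow> q2_cauchy Y \<Longrightarrow>
    Abs_Q2 X = Abs_Q2 Y \<longleftrightarrow> (\<lambda>n. q2_unorm (X n - Y n)) \<longlonglongrightarrow> 0"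
  using Quotient3_rel [OF Quotient3_Q2, of X Y] by (simp add: q2_rel_refl_iff) (simp add: q2_rel_def)

lemma q2_rel_unorm_lim:
  assumes "q2_rel X Y"
  shows "lim (\<lambda>n. q2_unorm (X n)) = lim (\<lambda>n. q2_unorm (Y n))"
proof -
  obtain L where L: "(\<lambda>n. q2_unorm (X n)) \<longlonglongrightarrow> L"
    using assms q2_cauchy_unorm by (auto simp: q2_rel_def convergent_def Cauchy_convergent_iff)
  have "(\<lambda>n. q2_unorm (X n) - q2_unorm (Y n)) \<longlonglongrightarrow> 0"
  proof (rule Lim_null_comparison)
    show "(\<lambda>n. q2_unorm (X n - Y n)) \<longlonglongrightarrow> 0"
      using assms by (simp add: q2_rel_def)
  qed (simp add: unorm_rev_triangle)
  from tendsto_diff [OF L this] have "(\<lambda>n. q2_unorm (Y n)) \<longlonglongrightarrow> L"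
    by simp
  with L show ?thesis
    by (simp add: limI)
qed

instantiation Q2 :: "{complex_star_algebra, real_normed_algebra}"
begin

lift_definition zero_Q2 :: Q2 is "\<lambda>_. 0"
  by (simp add: q2_rel_refl_iff)

lift_definition one_Q2 :: Q2 is "\<lambda>_. 1"
  by (simp add: q2_rel_refl_iff)

lift_definition plus_Q2 :: "Q2 \<Rightarrow> Q2 \<Rightarrow> Q2" is "\<lambda>X Y n. X n + Y n"
proof -
  fix X X' Y Y' assume *: "q2_rel X X'" "q2_rel Y Y'"
  then have "(\<lambda>n. q2_unorm (X n - X' n) + q2_unorm (Y n - Y' n)) \<longlonglongrightarrow> 0"
    by (auto simp: q2_rel_def intro: tendsto_add_zero)
  then have "(\<lambda>n. q2_unorm (X n + Y n - (X' n + Y' n))) \<longlonglongrightarrow> 0"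
    by (rule unorm_null_comparison) (simp add: add_diff_add unorm_add)
  with * show "q2_rel (\<lambda>n. X n + Y n) (\<lambda>n. X' n + Y' n)"
    by (simp add: q2_rel_def q2_cauchy_add)
qed

lift_definition uminus_Q2 :: "Q2 \<Rightarrow> Q2" is "\<lambda>X n. - X n"
  by (simp add: q2_rel_def q2_cauchy_uminus unorm_diff_commute)

lift_definition minus_Q2 :: "Q2 \<Rightarrow> Q2 \<Rightarrow> Q2" is "\<lambda>X Y n. X n - Y n"
proof -
  fix X X' Y Y' assume *: "q2_rel X X'" "q2_rel Y Y'"
  then have "(\<lambda>n. q2_unorm (X n - X' n) + q2_unorm (Y n - Y' n)) \<longlonglongrightarrow> 0"
    by (auto simp: q2_rel_def intro: tendsto_add_zero)
  then have "(\<lambda>n. q2_unorm (X n - Y n - (X' n - Y' n))) \<longlonglongrightarrow> 0"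
  proof (rule unorm_null_comparison)
    show "q2_unorm (X n - Y n - (X' n - Y' n)) \<le> q2_unorm (X n - X' n) + q2_unorm (Y n - Y' n)" for n
      using unorm_add [of "X n - X' n" "Y' n - Y n"] unorm_diff_commute [of "Y n" "Y' n"]
      by (simp add: algebra_simps)
  qed
  with * show "q2_rel (\<lambda>n. X n - Y n) (\<lambda>n. X' n - Y' n)"
    by (simp add: q2_rel_def q2_cauchy_diff)
qed

lift_definition times_Q2 :: "Q2 \<Rightarrow> Q2 \<Rightarrow> Q2" is "\<lambda>X Y n. X n * Y n"
proof -
  fix X X' Y Y' assume *: "q2_rel X X'" "q2_rel Y Y'"
  then obtain M N where M: "\<And>n. q2_unorm (X' n) \<le> M" and N: "\<And>n. q2_unorm (Y n) \<le> N"
    using q2_cauchy_bounded unfolding q2_rel_def by metis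
  have "(\<lambda>n. q2_unorm (X n - X' n) * N + M * q2_unorm (Y n - Y' n)) \<longlonglongrightarrow> 0"
    using * by (auto simp: q2_rel_def intro!: tendsto_add_zero tendsto_mult_left_zero tendsto_mult_right_zero)
  then have "(\<lambda>n. q2_unorm (X n * Y n - X' n * Y' n)) \<longlonglongrightarrow> 0"
    by (rule unorm_null_comparison) (rule unorm_mult_diff [OF N M])
  with * show "q2_rel (\<lambda>n. X n * Y n) (\<lambda>n. X' n * Y' n)"
    by (simp add: q2_rel_def q2_cauchy_mult)
qed

lift_definition scaleC_Q2 :: "complex \<Rightarrow> Q2 \<Rightarrow> Q2" is "\<lambda>c X n. free_scale c (X n)"
  by (auto simp: q2_rel_def q2_cauchy_scale free_scale_diff unorm_scale intro: tendsto_mult_right_zero)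

definition scaleR_Q2 :: "real \<Rightarrow> Q2 \<Rightarrow> Q2" where
  "scaleR_Q2 r x = of_real r *\<^sub>C x"

lift_definition star_Q2 :: "Q2 \<Rightarrow> Q2" is "\<lambda>X n. free_star (X n)"
  by (simp add: q2_rel_def q2_cauchy_star unorm_star flip: free_star_diff)

lift_definition norm_Q2 :: "Q2 \<Rightarrow> real" is "\<lambda>X. lim (\<lambda>n. q2_unorm (X n))"
  by (rule q2_rel_unorm_lim)

definition sgn_Q2 :: "Q2 \<Rightarrow> Q2" where "sgn_Q2 x = inverse (norm x) *\<^sub>R x"

definition dist_Q2 :: "Q2 \<Rightarrow> Q2 \<Rightarrow> real" where "dist_Q2 x y = norm (x - y)"

definition uniformity_Q2 :: "(Q2 \<times> Q2) filter" where
  "uniformity_Q2 = (INF e\<in>{0 <..}. principal {(x, y). dist x y < e})"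

definition open_Q2 :: "Q2 set \<Rightarrow> bool" where
  "open_Q2 S \<longleftrightarrow> (\<forall>x\<in>S. \<forall>\<^sub>F (x', y) in uniformity. x' = x \<longrightarrow> y \<in> S)"

lemma Abs_Q2_ops:
  assumes "q2_cauchy X" "q2_cauchy Y"
  shows "Abs_Q2 X + Abs_Q2 Y = Abs_Q2 (\<lambda>n. X n + Y n)"
    and "Abs_Q2 X - Abs_Q2 Y = Abs_Q2 (\<lambda>n. X n - Y n)"
    and "Abs_Q2 X * Abs_Q2 Y = Abs_Q2 (\<lambda>n. X n * Y n)"
  using assms by (simp_all add: plus_Q2.abs_eq minus_Q2.abs_eq times_Q2.abs_eq q2_rel_refl_iff)

lemma Abs_Q2_ops1:
  assumes "q2_cauchy X"
  shows "- Abs_Q2 X = Abs_Q2 (\<lambda>n. - X n)"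
    and "c *\<^sub>C Abs_Q2 X = Abs_Q2 (\<lambda>n. free_scale c (X n))"
    and "star (Abs_Q2 X) = Abs_Q2 (\<lambda>n. free_star (X n))"
  using assms by (simp_all add: uminus_Q2.abs_eq scaleC_Q2.abs_eq star_Q2.abs_eq q2_rel_refl_iff)

lemma norm_Abs_Q2_tendsto: "q2_cauchy X \<Longrightarrow> (\<lambda>n. q2_unorm (X n)) \<longlonglongrightarrow> norm (Abs_Q2 X)"
  using q2_cauchy_unorm [of X]
  by (simp add: norm_Q2.abs_eq q2_rel_refl_iff Cauchy_convergent_iff convergent_LIMSEQ_iff)

lemmas Abs_Q2_simps = zero_Q2_def one_Q2_def Abs_Q2_ops Abs_Q2_ops1 q2_cauchy_add q2_cauchy_diff
  q2_cauchy_mult q2_cauchy_uminus q2_cauchy_scale q2_cauchy_star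

lemma free_scale_simps:
  "free_scale c (a + b) = free_scale c a + free_scale c b"
  "free_scale (c + d) a = free_scale c a + free_scale d a"
  "free_scale c (free_scale d a) = free_scale (c * d) a"
  "free_scale 1 a = a"
  "free_scale c a * b = free_scale c (a * b)"
  "a * free_scale c b = free_scale c (a * b)"
proof -
  show "a * free_scale c b = free_scale c (a * b)"
    by (simp only: free_scale_def single_zero_central [of c a] flip: mult.assoc)
  show "free_scale c (free_scale d a) = free_scale (c * d) a"
    by (simp add: free_scale_def mult_single flip: mult.assoc)
qed (simp_all add: free_scale_def distrib_left distrib_right single_add mult.assoc)

lemma norm_scaleC_Q2: "norm (c *\<^sub>C x) = cmod c * norm (x :: Q2)"
proof (induct x)
  case (Abs X)
  have "(\<lambda>n. q2_unorm (free_scale c (X n))) \<longlonglongrightarrow> cmod c * norm (Abs_Q2 X)"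
    using norm_Abs_Q2_tendsto [OF Abs] by (simp add: unorm_scale tendsto_mult_left)
  then show ?case
    using LIMSEQ_unique [OF norm_Abs_Q2_tendsto [OF q2_cauchy_scale [OF Abs]]] Abs
    by (simp add: Abs_Q2_ops1)
qed

instance
proof
  fix x y z :: Q2 and c d :: complex and r q :: real
  show "x + y + z = x + (y + z)"
    by (induct x, induct y, induct z) (simp add: Abs_Q2_simps add.assoc)
  show "x + y = y + x"
    by (induct x, induct y) (simp add: Abs_Q2_simps add.commute)
  show "0 + x = x"
    by (induct x) (simp add: Abs_Q2_simps)
  show "- x + x = 0"
    by (induct x) (simp add: Abs_Q2_simps)
  show "x - y = x + - y"
    by (induct x, induct y) (simp add: Abs_Q2_simps)
  show "x * y * z = x * (y * z)"
    by (induct x, induct y, induct z) (simp add: Abs_Q2_simps mult.assoc)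
  show "1 * x = x" "x * 1 = x"
    by (induct x; simp add: Abs_Q2_simps)+
  show "(x + y) * z = x * z + y * z"
    by (induct x, induct y, induct z) (simp add: Abs_Q2_simps distrib_right)
  show "x * (y + z) = x * y + x * z"
    by (induct x, induct y, induct z) (simp add: Abs_Q2_simps distrib_left)
  show 1: "c *\<^sub>C (x + y) = c *\<^sub>C x + c *\<^sub>C y" for c
    by (induct x, induct y) (simp add: Abs_Q2_simps free_scale_simps)
  show 2: "(c + d) *\<^sub>C x = c *\<^sub>C x + d *\<^sub>C x" for c d
    by (induct x) (simp add: Abs_Q2_simps free_scale_simps)
  show 3: "c *\<^sub>C d *\<^sub>C x = (c * d) *\<^sub>C x" for c d
    by (induct x) (simp add: Abs_Q2_simps free_scale_simps)
  show 4: "1 *\<^sub>C x = x"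
    by (induct x) (simp add: Abs_Q2_simps free_scale_simps)
  show 5: "(c *\<^sub>C x) * y = c *\<^sub>C (x * y)" for c
    by (induct x, induct y) (simp add: Abs_Q2_simps free_scale_simps)
  show 6: "x * (c *\<^sub>C y) = c *\<^sub>C (x * y)" for c
    by (induct x, induct y) (simp add: Abs_Q2_simps free_scale_simps)
  show "star (x + y) = star x + star y"
    by (induct x, induct y) (simp add: Abs_Q2_simps free_star_add)
  show "star (c *\<^sub>C x) = cnj c *\<^sub>C star x"
    by (induct x) (simp add: Abs_Q2_simps free_scale_star)
  show "star (x * y) = star y * star x"
    by (induct x, induct y) (simp add: Abs_Q2_simps free_star_mult)
  show "star (star x) = x"
    by (induct x) (simp add: Abs_Q2_simps free_star_star)
  show "r *\<^sub>R (x + y) = r *\<^sub>R x + r *\<^sub>R y" "(r + q) *\<^sub>R x = r *\<^sub>R x + q *\<^sub>R x"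
    "r *\<^sub>R q *\<^sub>R x = (r * q) *\<^sub>R x" "1 *\<^sub>R x = x"
    "r *\<^sub>R x * y = r *\<^sub>R (x * y)" "x * r *\<^sub>R y = r *\<^sub>R (x * y)"
    by (simp_all add: scaleR_Q2_def 1 2 3 4 5 6)
  show "sgn x = inverse (norm x) *\<^sub>R x"
    by (rule sgn_Q2_def)
  show "dist x y = norm (x - y)"
    by (rule dist_Q2_def)
  show "norm x = 0 \<longleftrightarrow> x = 0"
  proof (induct x)
    case (Abs X)
    have "norm (Abs_Q2 X) = 0 \<longleftrightarrow> (\<lambda>n. q2_unorm (X n)) \<longlonglongrightarrow> 0"
      using norm_Abs_Q2_tendsto [OF Abs] by (metis LIMSEQ_unique)
    also have "\<dots> \<longleftrightarrow> Abs_Q2 X = 0"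
      using Abs by (simp add: zero_Q2_def Abs_Q2_eq_iff)
    finally show ?case .
  qed
  show "norm (x + y) \<le> norm x + norm y"
  proof (induct x, induct y)
    case (Abs Y X)
    show ?case
    proof (rule LIMSEQ_le)
      show "(\<lambda>n. q2_unorm (X n + Y n)) \<longlonglongrightarrow> norm (Abs_Q2 X + Abs_Q2 Y)"
        using Abs by (simp add: Abs_Q2_simps norm_Abs_Q2_tendsto)
      show "(\<lambda>n. q2_unorm (X n) + q2_unorm (Y n)) \<longlonglongrightarrow> norm (Abs_Q2 X) + norm (Abs_Q2 Y)"
        using Abs by (intro tendsto_add norm_Abs_Q2_tendsto)
    qed (simp add: unorm_add)
  qed
  show "norm (x * y) \<le> norm x * norm y"
  proof (induct x, induct y)
    case (Abs Y X)
    show ?case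
    proof (rule LIMSEQ_le)
      show "(\<lambda>n. q2_unorm (X n * Y n)) \<longlonglongrightarrow> norm (Abs_Q2 X * Abs_Q2 Y)"
        using Abs by (simp add: Abs_Q2_simps norm_Abs_Q2_tendsto)
      show "(\<lambda>n. q2_unorm (X n) * q2_unorm (Y n)) \<longlonglongrightarrow> norm (Abs_Q2 X) * norm (Abs_Q2 Y)"
        using Abs by (intro tendsto_mult norm_Abs_Q2_tendsto)
    qed (simp add: unorm_mult)
  qed
  show "norm (r *\<^sub>R x) = \<bar>r\<bar> * norm x"
    by (simp add: scaleR_Q2_def norm_scaleC_Q2)
  show "uniformity = (INF e\<in>{0 <..}. principal {(x, y :: Q2). dist x y < e})"
    by (rule uniformity_Q2_def)
  show "open S \<longleftrightarrow> (\<forall>x\<in>S. \<forall>\<^sub>F (x', y) in uniformity. x' = x \<longrightarrow> y \<in> S)" for S :: "Q2 set"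
    by (rule open_Q2_def)
qed

end

definition q2_emb :: "q2_free \<Rightarrow> Q2" where
  "q2_emb a = Abs_Q2 (\<lambda>_. a)"

definition q2_U :: Q2 where "q2_U = q2_emb free_U"
definition q2_S :: Q2 where "q2_S = q2_emb free_S"

lemma q2_emb_simps:
  "q2_emb (a + b) = q2_emb a + q2_emb b"
  "q2_emb (a - b) = q2_emb a - q2_emb b"
  "q2_emb (a * b) = q2_emb a * q2_emb b"
  "q2_emb (free_scale c a) = c *\<^sub>C q2_emb a"
  "q2_emb (free_star a) = star (q2_emb a)"
  "q2_emb 0 = 0"
  "q2_emb 1 = 1"
  by (simp_all add: q2_emb_def Abs_Q2_simps)

lemma norm_q2_emb: "norm (q2_emb a) = q2_unorm a"
  using norm_Abs_Q2_tendsto [of "\<lambda>_. a"] by (simp add: q2_emb_def LIMSEQ_const_iff)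

lemma q2_emb_tendsto:
  assumes "q2_cauchy X"
  shows "(\<lambda>n. q2_emb (X n)) \<longlonglongrightarrow> Abs_Q2 X"
proof (rule metric_LIMSEQ_I)
  fix e :: real assume "e > 0"
  then obtain N where N: "\<forall>m\<ge>N. \<forall>n\<ge>N. q2_unorm (X m - X n) < e / 2"
    using assms half_gt_zero unfolding q2_cauchy_def by blast
  have "dist (q2_emb (X m)) (Abs_Q2 X) < e" if "m \<ge> N" for m
  proof -
    have "norm (q2_emb (X m) - Abs_Q2 X) \<le> e / 2"
    proof (rule LIMSEQ_le_const2)
      show "(\<lambda>n. q2_unorm (X m - X n)) \<longlonglongrightarrow> norm (q2_emb (X m) - Abs_Q2 X)"
        using assms by (simp add: q2_emb_def Abs_Q2_simps norm_Abs_Q2_tendsto)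
      show "\<exists>N. \<forall>n\<ge>N. q2_unorm (X m - X n) \<le> e / 2"
        using N that by (auto intro: less_imp_le)
    qed
    then show ?thesis
      using \<open>e > 0\<close> by (simp add: dist_norm)
  qed
  then show "\<exists>N. \<forall>m\<ge>N. dist (q2_emb (X m)) (Abs_Q2 X) < e"
    by blast
qed

lemma q2_emb_dense:
  assumes "e > 0"
  obtains a where "dist (q2_emb a) x < e"
proof (induct x arbitrary: thesis)
  case (Abs X)
  show ?case
    using metric_LIMSEQ_D [OF q2_emb_tendsto [OF Abs(1)] assms] Abs(2) by blast
qed

instance Q2 :: banach
proof
  fix Z :: "nat \<Rightarrow> Q2" assume Z: "Cauchy Z"
  have "\<forall>n. \<exists>a. dist (q2_emb a) (Z n) < inverse (Suc n)"
    using q2_emb_dense by (metis inverse_positive_iff_positive of_nat_0_less_iff zero_less_Suc)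
  then obtain X where X: "\<And>n. dist (q2_emb (X n)) (Z n) < inverse (Suc n)"
    by metis
  have d: "(\<lambda>n. dist (q2_emb (X n)) (Z n)) \<longlonglongrightarrow> 0"
    by (rule Lim_null_comparison [OF _ LIMSEQ_inverse_real_of_nat])
      (use X in \<open>auto intro!: always_eventually less_imp_le\<close>)
  have "q2_cauchy X"
    unfolding q2_cauchy_def
  proof (intro allI impI)
    fix e :: real assume "e > 0"
    then have "e / 3 > 0" by simp
    obtain M where M: "\<And>m n. m \<ge> M \<Longrightarrow> n \<ge> M \<Longrightarrow> dist (Z m) (Z n) < e / 3"
      using metric_CauchyD [OF Z \<open>e / 3 > 0\<close>] by blast
    obtain N where N: "\<And>n. n \<ge> N \<Longrightarrow> dist (q2_emb (X n)) (Z n) < e / 3"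
      using metric_LIMSEQ_D [OF d \<open>e / 3 > 0\<close>] by auto
    have "q2_unorm (X m - X n) < e" if "m \<ge> max M N" "n \<ge> max M N" for m n
    proof -
      have "q2_unorm (X m - X n) = dist (q2_emb (X m)) (q2_emb (X n))"
        by (simp add: dist_norm norm_q2_emb flip: q2_emb_simps)
      also have "\<dots> \<le> dist (q2_emb (X m)) (Z m) + dist (Z m) (Z n) + dist (q2_emb (X n)) (Z n)"
        by metric
      also have "\<dots> < e / 3 + e / 3 + e / 3"
        using that by (intro add_strict_mono M N) auto
      finally show ?thesis by simp
    qed
    then show "\<exists>N. \<forall>m\<ge>N. \<forall>n\<ge>N. q2_unorm (X m - X n) < e"
      by blast
  qed
  then have "(\<lambda>n. q2_emb (X n)) \<longlonglongrightarrow> Abs_Q2 X"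
    by (rule q2_emb_tendsto)
  then have "Z \<longlonglongrightarrow> Abs_Q2 X"
    by (rule Lim_transform2) (use d in \<open>simp add: dist_norm tendsto_norm_zero_iff\<close>)
  then show "convergent Z"
    by (auto simp: convergent_def)
qed

instance Q2 :: cstar_algebra
proof
  fix x :: Q2 and r :: real and c :: complex
  show "r *\<^sub>R x = of_real r *\<^sub>C x"
    by (rule scaleR_Q2_def)
  show "norm (c *\<^sub>C x) = cmod c * norm x"
    by (rule norm_scaleC_Q2)
  show "norm (star x * x) = (norm x)\<^sup>2"
  proof (induct x)
    case (Abs X)
    have "(\<lambda>n. q2_unorm (free_star (X n) * X n)) \<longlonglongrightarrow> (norm (Abs_Q2 X))\<^sup>2"
      using tendsto_power [OF norm_Abs_Q2_tendsto [OF Abs], of 2] by (simp add: unorm_cstar)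
    moreover have "(\<lambda>n. q2_unorm (free_star (X n) * X n)) \<longlonglongrightarrow> norm (star (Abs_Q2 X) * Abs_Q2 X)"
      using Abs by (simp add: Abs_Q2_simps norm_Abs_Q2_tendsto)
    ultimately show ?case
      by (simp add: LIMSEQ_unique)
  qed
qed


section \<open>The universal property\<close>

definition q2_relations :: "'a::cstar_algebra \<Rightarrow> 'a \<Rightarrow> bool" where
  "q2_relations u s \<longleftrightarrow>
     unitary_elt u \<and> isometry_elt s \<and> s * u = u\<^sup>2 * s \<and>
     s * star s + u * s * star s * star u = 1"

lemma q2_emb_relator: "r \<in> q2_relators \<Longrightarrow> q2_emb r = 0"
  using norm_q2_emb [of r] by (simp add: unorm_relator)

lemma q2_relations_q2: "q2_relations q2_U q2_S"
proof -
  have "q2_emb (free_star free_U * free_U - 1) = 0"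
    "q2_emb (free_U * free_star free_U - 1) = 0"
    "q2_emb (free_star free_S * free_S - 1) = 0"
    "q2_emb (free_S * free_U - free_U\<^sup>2 * free_S) = 0"
    "q2_emb (free_S * free_star free_S + free_U * free_S * free_star free_S * free_star free_U - 1) = 0"
    by (rule q2_emb_relator, simp add: q2_relators_def)+
  then show ?thesis
    by (simp add: q2_relations_def unitary_elt_def isometry_elt_def q2_U_def q2_S_def
        power2_eq_square q2_emb_simps)
qed

lemma scaleC_zero_left: "0 *\<^sub>C x = (0::'a::complex_star_algebra)"
  using scaleC_add_left [of 0 0 x] by simp

lemma star_zero: "star 0 = (0::'a::complex_star_algebra)"
  using star_add [of 0 "0::'a"] by simp

lemma star_prod_list: "star (prod_list xs) = prod_list (rev (map star (xs :: 'a::complex_star_algebra list)))"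
  by (induction xs) (simp_all add: star_one star_mult)

context
  fixes u s :: "'b::cstar_algebra"
begin

fun ev_letter :: "q2_letter \<Rightarrow> 'b" where
  "ev_letter LU = u"
| "ev_letter LUs = star u"
| "ev_letter LS = s"
| "ev_letter LSs = star s"

definition ev_word :: "q2_word \<Rightarrow> 'b" where
  "ev_word w = prod_list (map ev_letter (letters w))"

definition ev :: "q2_free \<Rightarrow> 'b" where
  "ev a = (\<Sum>w\<in>Poly_Mapping.keys a. Poly_Mapping.lookup a w *\<^sub>C ev_word w)"

lemma ev_word_zero: "ev_word 0 = 1"
  by (simp add: ev_word_def zero_q2_word_def)

lemma ev_word_add: "ev_word (v + w) = ev_word v * ev_word w"
  by (simp add: ev_word_def plus_q2_word_def)

lemma ev_word_star: "ev_word (word_star w) = star (ev_word w)"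
proof -
  have "ev_letter (letter_star l) = star (ev_letter l)" for l
    by (cases l) (simp_all add: star_star)
  then show ?thesis
    by (simp add: ev_word_def word_star_def star_prod_list rev_map o_def)
qed

lemma ev_zero: "ev 0 = 0"
  by (simp add: ev_def)

lemma ev_single: "ev (Poly_Mapping.single w c) = c *\<^sub>C ev_word w"
  by (simp add: ev_def scaleC_zero_left)

lemma ev_add: "ev (a + b) = ev a + ev b"
  unfolding ev_def
  by (rule setsum_keys_plus_distrib) (simp_all add: scaleC_zero_left scaleC_add_left)

lemma ev_diff: "ev (a - b) = ev a - ev b"
  using ev_add [of "a - b" b] by simp

lemma ev_mult: "ev (a * b) = ev a * ev b"
proof (induction a rule: free_induct)
  case (single v c)
  show ?case
    by (induction b rule: free_induct)
      (simp_all add: ev_zero ev_single mult_single ev_word_add distrib_left ev_add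
        mult_scaleC_left mult_scaleC_right scaleC_scaleC mult.commute [of c])
qed (simp_all add: ev_zero distrib_right ev_add)

lemma ev_one: "ev 1 = 1"
  using ev_single [of 0 1] by (simp add: ev_word_zero scaleC_one)

lemma ev_scale: "ev (free_scale c a) = c *\<^sub>C ev a"
  by (simp add: free_scale_def ev_mult ev_single ev_word_zero mult_scaleC_left)

lemma ev_star: "ev (free_star a) = star (ev a)"
  by (induction a rule: free_induct)
    (simp_all add: ev_zero star_zero ev_single free_star_single ev_word_star star_scaleC
      free_star_add ev_add star_add)

lemma ev_U: "ev free_U = u" and ev_S: "ev free_S = s"
  by (simp_all add: free_U_def free_S_def ev_single ev_word_def scaleC_one)

lemma norm_ev_le:
  assumes "q2_relations u s"
  shows "norm (ev a) \<le> q2_unorm a"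
proof -
  have "(\<lambda>a. norm (ev a)) \<in> q2_seminorms"
    using assms
    by (auto simp: q2_seminorms_def cstar_seminorm_def ev_add ev_scale ev_mult ev_star ev_diff ev_one
        ev_U ev_S norm_triangle_ineq norm_scaleC norm_mult_ineq cstar_identity q2_relators_def
        q2_relations_def unitary_elt_def isometry_elt_def power2_eq_square)
  then show ?thesis
    by (rule sn_le_unorm)
qed

end

text \<open>A *-homomorphism between C*-algebras is automatically continuous. Continuity is mentioned in the
  uniqueness part below only because that fact is not proved here.\<close>

theorem Q2_universal:
  fixes u s :: "'b::cstar_algebra"
  assumes rel: "q2_relations u s"
  shows "\<exists>!\<phi> :: Q2 \<Rightarrow> 'b. star_hom \<phi> \<and> continuous_on UNIV \<phi> \<and> \<phi> q2_U = u \<and> \<phi> q2_S = s"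
proof (rule ex_ex1I)
  let ?ev = "ev u s"
  have le: "norm (?ev a - ?ev b) \<le> q2_unorm (a - b)" for a b
    using norm_ev_le [OF rel, of "a - b"] by (simp add: ev_diff)
  have "\<exists>y. \<forall>X. q2_cauchy X \<and> Abs_Q2 X = x \<longrightarrow> (\<lambda>n. ?ev (X n)) \<longlonglongrightarrow> y" for x
  proof (induct x)
    case (Abs X)
    have "Cauchy (\<lambda>n. ?ev (X n))"
    proof (rule CauchyI)
      fix e :: real assume "e > 0"
      then show "\<exists>N. \<forall>m\<ge>N. \<forall>n\<ge>N. norm (?ev (X m) - ?ev (X n)) < e"
        using Abs le unfolding q2_cauchy_def by (meson le_less_trans)
    qed
    then obtain y where y: "(\<lambda>n. ?ev (X n)) \<longlonglongrightarrow> y"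
      by (auto simp: Cauchy_convergent_iff convergent_def)
    have "(\<lambda>n. ?ev (Y n)) \<longlonglongrightarrow> y" if Y: "q2_cauchy Y" "Abs_Q2 Y = Abs_Q2 X" for Y
    proof (rule Lim_transform [OF y])
      have "(\<lambda>n. q2_unorm (Y n - X n)) \<longlonglongrightarrow> 0"
        using Y Abs by (simp add: Abs_Q2_eq_iff)
      then show "(\<lambda>n. ?ev (Y n) - ?ev (X n)) \<longlonglongrightarrow> 0"
        by (rule Lim_null_comparison [rotated]) (simp add: le)
    qed
    then show ?case by blast
  qed
  then obtain \<phi> where \<phi>: "\<And>X. q2_cauchy X \<Longrightarrow> (\<lambda>n. ?ev (X n)) \<longlonglongrightarrow> \<phi> (Abs_Q2 X)"
    by metis
  have emb: "\<phi> (q2_emb a) = ?ev a" for a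
    using \<phi> [of "\<lambda>_. a"] by (simp add: q2_emb_def LIMSEQ_const_iff)
  have add: "\<phi> (x + y) = \<phi> x + \<phi> y" for x y
  proof (induct x, induct y)
    case (Abs Y X)
    have "(\<lambda>n. ?ev (X n + Y n)) \<longlonglongrightarrow> \<phi> (Abs_Q2 X) + \<phi> (Abs_Q2 Y)"
      unfolding ev_add using Abs by (intro tendsto_add \<phi>)
    then show ?case
      using \<phi> [OF q2_cauchy_add [OF Abs(2,1)]] Abs by (simp add: Abs_Q2_simps LIMSEQ_unique)
  qed
  have mult: "\<phi> (x * y) = \<phi> x * \<phi> y" for x y
  proof (induct x, induct y)
    case (Abs Y X)
    have "(\<lambda>n. ?ev (X n * Y n)) \<longlonglongrightarrow> \<phi> (Abs_Q2 X) * \<phi> (Abs_Q2 Y)"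
      unfolding ev_mult using Abs by (intro tendsto_mult \<phi>)
    then show ?case
      using \<phi> [OF q2_cauchy_mult [OF Abs(2,1)]] Abs by (simp add: Abs_Q2_simps LIMSEQ_unique)
  qed
  have scale: "\<phi> (c *\<^sub>C x) = c *\<^sub>C \<phi> x" for c x
  proof -
    have "\<phi> (q2_emb (free_scale c 1) * x) = ?ev (free_scale c 1) * \<phi> x"
      by (simp only: mult emb)
    then show ?thesis
      by (simp add: q2_emb_simps ev_scale ev_one mult_scaleC_left)
  qed
  have norm: "norm (\<phi> x) \<le> norm x" for x
  proof (induct x)
    case (Abs X)
    show ?case
      using tendsto_norm [OF \<phi> [OF Abs]] norm_Abs_Q2_tendsto [OF Abs]
      by (rule LIMSEQ_le) (simp add: norm_ev_le [OF rel])
  qed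
  have norm_star: "norm (star y) = norm y" for y :: "'c::cstar_algebra"
  proof -
    have *: "norm z \<le> norm (star z)" for z :: 'c
    proof (cases "z = 0")
      case False
      have "norm z * norm z \<le> norm (star z) * norm z"
        using norm_mult_ineq [of "star z" z] by (simp add: cstar_identity power2_eq_square)
      with False show ?thesis by (simp add: mult_le_cancel_right)
    qed simp
    show ?thesis
      using * [of y] * [of "star y"] by (simp add: star_star)
  qed
  have star: "\<phi> (star x) = star (\<phi> x)" for x
  proof (induct x)
    case (Abs X)
    have "(\<lambda>n. star (?ev (X n)) - star (\<phi> (Abs_Q2 X))) \<longlonglongrightarrow> 0"
    proof (rule Lim_null_comparison)
      show "(\<lambda>n. norm (?ev (X n) - \<phi> (Abs_Q2 X))) \<longlonglongrightarrow> 0"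
        using \<phi> [OF Abs] by (simp add: LIM_zero tendsto_norm_zero)
      have "star a - star b = star (a - b)" for a b :: 'b
        using star_add [of "a - b" b] by simp
      then show "\<forall>\<^sub>F n in sequentially. norm (star (?ev (X n)) - star (\<phi> (Abs_Q2 X))) \<le>
          norm (?ev (X n) - \<phi> (Abs_Q2 X))"
        by (simp add: norm_star)
    qed
    then have "(\<lambda>n. ?ev (free_star (X n))) \<longlonglongrightarrow> star (\<phi> (Abs_Q2 X))"
      by (simp add: ev_star LIM_zero_iff)
    then show ?case
      using \<phi> [OF q2_cauchy_star [OF Abs]] Abs by (simp add: Abs_Q2_simps LIMSEQ_unique)
  qed
  have "bounded_linear \<phi>"
    by (rule bounded_linear_intro [of _ 1]) (simp_all add: add scaleR_scaleC scale norm)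
  then have "continuous_on UNIV \<phi>"
    by (rule linear_continuous_on)
  moreover have "star_hom \<phi>"
    using emb [of 1] by (simp add: star_hom_def add scale mult star ev_one q2_emb_simps)
  ultimately show "\<exists>\<phi>. star_hom \<phi> \<and> continuous_on UNIV \<phi> \<and> \<phi> q2_U = u \<and> \<phi> q2_S = s"
    by (auto simp: q2_U_def q2_S_def emb ev_U ev_S)
next
  fix \<phi> \<psi> :: "Q2 \<Rightarrow> 'b"
  assume \<phi>: "star_hom \<phi> \<and> continuous_on UNIV \<phi> \<and> \<phi> q2_U = u \<and> \<phi> q2_S = s"
    and \<psi>: "star_hom \<psi> \<and> continuous_on UNIV \<psi> \<and> \<psi> q2_U = u \<and> \<psi> q2_S = s"
  have emb: "\<theta> (q2_emb a) = ev u s a"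
    if \<theta>: "star_hom \<theta>" "\<theta> q2_U = u" "\<theta> q2_S = s" for \<theta> a
  proof -
    have \<theta>_simps: "\<theta> (x + y) = \<theta> x + \<theta> y" "\<theta> (x * y) = \<theta> x * \<theta> y" "\<theta> (c *\<^sub>C x) = c *\<^sub>C \<theta> x"
      "\<theta> (star x) = star (\<theta> x)" "\<theta> 1 = 1" for x y c
      using \<theta>(1) by (simp_all add: star_hom_def)
    have \<theta>0: "\<theta> 0 = 0"
      using \<theta>_simps(1) [of 0 0] by simp
    have letter: "\<theta> (q2_emb (Poly_Mapping.single (Word [l]) 1)) = ev_letter u s l" for l
    proof -
      have "Poly_Mapping.single (Word [LUs]) 1 = free_star free_U"
        "Poly_Mapping.single (Word [LSs]) 1 = free_star free_S"
        by (simp_all add: free_U_def free_S_def free_star_single word_star_def)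
      then show ?thesis
        using \<theta>(2,3)
        by (cases l) (simp_all add: q2_U_def q2_S_def q2_emb_simps \<theta>_simps flip: free_U_def free_S_def)
    qed
    have word: "\<theta> (q2_emb (Poly_Mapping.single (Word ls) 1)) = ev_word u s (Word ls)" for ls
    proof (induction ls)
      case Nil
      show ?case
        using ev_word_zero [of u s] by (simp add: q2_emb_simps \<theta>_simps flip: zero_q2_word_def)
    next
      case (Cons l ls)
      have "Poly_Mapping.single (Word (l # ls)) (1::complex) =
          Poly_Mapping.single (Word [l]) 1 * Poly_Mapping.single (Word ls) 1"
        by (simp add: mult_single plus_q2_word_def)
      then show ?case
        by (simp add: q2_emb_simps \<theta>_simps letter Cons) (simp add: ev_word_def)
    qed
    show ?thesis
    proof (induction a rule: free_induct)
      case (single w c)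
      have "Poly_Mapping.single w c = free_scale c (Poly_Mapping.single w 1)"
        by (simp add: free_scale_def mult_single)
      then show ?case
        using word [of "letters w"] by (simp add: q2_emb_simps \<theta>_simps ev_scale ev_single scaleC_one)
    qed (simp_all add: q2_emb_simps \<theta>_simps \<theta>0 ev_zero ev_add)
  qed
  show "\<phi> = \<psi>"
  proof
    fix x
    show "\<phi> x = \<psi> x"
    proof (induct x)
      case (Abs X)
      have "(\<lambda>n. \<theta> (q2_emb (X n))) \<longlonglongrightarrow> \<theta> (Abs_Q2 X)" if "continuous_on UNIV \<theta>"
        for \<theta> :: "Q2 \<Rightarrow> 'b"
        using continuous_on_tendsto_compose [OF that q2_emb_tendsto [OF Abs]] by simp
      from this [of \<phi>] this [of \<psi>] show ?case
        using \<phi> \<psi> by (simp add: emb LIMSEQ_unique)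
    qed
  qed
qed

end

theory Submission
  imports Defs
begin

text \<open>
  Write \<open>U\<close>, \<open>S\<close> for the two generators. Two kinds of automorphisms are easy to
  come by from the universal property: the flip \<open>\<kappa>\<close> with \<open>U \<mapsto> U\<^sup>*\<close>, \<open>S \<mapsto> S\<close>
  (\<open>q2_relations_flip\<close>), and, for every unitary \<open>v\<close> in the C*-algebra generated by \<open>U\<close>, the map
  \<open>\<beta>\<close> with \<open>U \<mapsto> U\<close>, \<open>S \<mapsto> v S\<close> (\<open>q2_relations_phase\<close>). Think of \<open>v\<close> as \<open>f(U)\<close> for a function
  \<open>f\<close> from the unit circle to itself.

  Suppose that \<open>\<beta> \<circ> \<kappa>\<close> and \<open>\<kappa> \<circ> \<beta>\<close> differ by conjugation with a unitary \<open>w\<close>. Both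
  composites send \<open>U\<close> to \<open>U\<^sup>*\<close>, so \<open>w\<close> commutes with \<open>U\<close>; comparing the images of \<open>S\<close>
  gives \<open>v S w = w \<kappa>(v) S\<close>. To see what this says, let \<open>U\<close> and \<open>S\<close> act on finitely supported
  functions on the unit circle (with the discrete topology) by
  \<open>(U g)(z) = z g(z)\<close> and \<open>(S g)(z) = g(z\<^sup>2) / \<surd>2\<close>. Here \<open>U\<close> is diagonal with simple
  spectrum, so \<open>w\<close> is diagonal too, \<open>(w g)(z) = h(z) g(z)\<close>, and \<open>h\<close> has no zeros because \<open>w\<close> is
  invertible (\<open>column_commuting_U\<close>, \<open>column_diagonal_nonzero\<close>). The relation between \<open>v\<close> and \<open>w\<close>
  becomes the coboundary equation \<open>f(z) h(z\<^sup>2) = f(cnj z) h(z)\<close>; with its denominators cleared it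
  is an instance of \<open>diagonal_cocycle\<close>.
  Multiplied over a periodic orbit of the squaring map it eliminates \<open>h\<close>: the product of \<open>f\<close> over
  the orbit must equal its product over the complex conjugate orbit. The shortest periodic orbit
  that is not its own conjugate is \<open>\<zeta>, \<zeta>\<^sup>2, \<zeta>\<^sup>4\<close> for a primitive seventh root of unity \<open>\<zeta>\<close>, and
  for \<open>f(z) = (1 - z / 2) / (1 - cnj z / 2)\<close> the two products are different
  (\<open>seventh_root_of_unity_product\<close>).

  Two points need care. The unitary \<open>v = f(U)\<close> is obtained without functional calculus, as
  \<open>t (t\<^sup>*)\<^sup>-\<^sup>1\<close> for the normal invertible element \<open>t = 1 - U / 2\<close>; any homomorphism that is
  known on \<open>U\<close> is then known on \<open>v\<close>, since inverses are unique. And instead of a completed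
  Hilbert space with its algebra of bounded operators, only the pre-Hilbert space of finitely
  supported functions is used: the operator norm there is one of the C*-seminorms whose supremum is
  the norm of \<open>Q2\<close> (\<open>onorm_circ_op_in_q2_seminorms\<close>), so that all matrix coefficients extend
  continuously to \<open>Q2\<close>, and matrix coefficients are all that the argument evaluates.
\<close>

section \<open>Action of the free *-algebra on functions on the plane\<close>

text \<open>The formulas are local (each value depends on finitely many values of the argument), so they
  make sense for arbitrary functions. This matters below: the columns of the matrix of an element of
  \<open>Q2\<close> need not have finite support, yet elements of the free algebra can be applied to them. The
  relators act as zero only on functions that vanish off the unit circle.\<close>

fun letter_op :: "q2_letter \<Rightarrow> (complex \<Rightarrow> complex) \<Rightarrow> complex \<Rightarrow> complex" where
  "letter_op LU f = (\<lambda>z. z * f z)"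
| "letter_op LUs f = (\<lambda>z. cnj z * f z)"
| "letter_op LS f = (\<lambda>z. f (z\<^sup>2) / complex_of_real (sqrt 2))"
| "letter_op LSs f = (\<lambda>z. (f (csqrt z) + f (- csqrt z)) / complex_of_real (sqrt 2))"

definition word_op :: "q2_word \<Rightarrow> (complex \<Rightarrow> complex) \<Rightarrow> complex \<Rightarrow> complex" where
  "word_op w = foldr letter_op (letters w)"

definition act :: "q2_free \<Rightarrow> (complex \<Rightarrow> complex) \<Rightarrow> complex \<Rightarrow> complex" where
  "act a f z = (\<Sum>w\<in>Poly_Mapping.keys a. Poly_Mapping.lookup a w * word_op w f z)"

lemma word_op_zero: "word_op 0 f = f"
  by (simp add: word_op_def zero_q2_word_def)

lemma word_op_add: "word_op (v + w) f = word_op v (word_op w f)"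
  by (simp add: word_op_def plus_q2_word_def)

lemma word_op_Cons: "word_op (Word (l # ls)) f = letter_op l (word_op (Word ls) f)"
  by (simp add: word_op_def)

lemma letter_op_linear:
  "letter_op l (\<lambda>z. c * f z + d * g z) = (\<lambda>z. c * letter_op l f z + d * letter_op l g z)"
  by (cases l) (auto simp: fun_eq_iff field_simps)

lemma word_op_linear:
  "word_op w (\<lambda>z. c * f z + d * g z) = (\<lambda>z. c * word_op w f z + d * word_op w g z)"
proof (cases w)
  case (Word ls)
  have "word_op (Word ls) (\<lambda>z. c * f z + d * g z) = (\<lambda>z. c * word_op (Word ls) f z + d * word_op (Word ls) g z)"
    by (induction ls) (simp_all add: word_op_Cons letter_op_linear, simp add: word_op_def)
  then show ?thesis by (simp add: Word)
qed

lemma act_zero: "act 0 f = (\<lambda>z. 0)"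
  by (simp add: act_def fun_eq_iff)

lemma act_single: "act (Poly_Mapping.single w c) f = (\<lambda>z. c * word_op w f z)"
  by (auto simp add: act_def fun_eq_iff)

lemma act_add: "act (a + b) f = (\<lambda>z. act a f z + act b f z)"
  unfolding act_def fun_eq_iff
  by (intro allI setsum_keys_plus_distrib) (simp_all add: distrib_right)

lemma act_diff: "act (a - b) f = (\<lambda>z. act a f z - act b f z)"
  using act_add [of "a - b" b f] by (simp add: fun_eq_iff)

lemma act_linear: "act a (\<lambda>z. c * f z + d * g z) = (\<lambda>z. c * act a f z + d * act a g z)"
  by (induction a rule: free_induct)
    (simp_all add: act_zero act_single word_op_linear act_add algebra_simps)

lemma act_cmult: "act a (\<lambda>z. c * f z) = (\<lambda>z. c * act a f z)"
  using act_linear [of a c f 0 f] by simp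

lemma act_mult: "act (a * b) f = act a (act b f)"
proof (induction a rule: free_induct)
  case (single v c)
  show ?case
  proof (induction b rule: free_induct)
    case zero
    show ?case
      using act_cmult [of "Poly_Mapping.single v c" 0 f] by (simp add: act_zero)
  next
    case (single w d)
    show ?case
      using word_op_linear [of v d "word_op w f" 0 "word_op w f"]
      by (simp add: act_single mult_single word_op_add mult.assoc)
  next
    case (add a b)
    then show ?case
      using act_linear [of "Poly_Mapping.single v c" 1 "act a f" 1 "act b f"]
      by (simp add: distrib_left act_add)
  qed
qed (simp_all add: act_zero act_add distrib_right)

lemma act_one: "act 1 f = f"
  using act_single [of 0 1 f] by (simp add: word_op_zero)

lemma act_scale: "act (free_scale c a) f = (\<lambda>z. c * act a f z)"
  by (simp add: free_scale_def act_mult act_single word_op_zero)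

lemma act_U: "act free_U f = (\<lambda>z. z * f z)"
  and act_S: "act free_S f = (\<lambda>z. f (z\<^sup>2) / complex_of_real (sqrt 2))"
  and act_U_star: "act (free_star free_U) f = (\<lambda>z. cnj z * f z)"
  and act_S_star: "act (free_star free_S) f
    = (\<lambda>z. (f (csqrt z) + f (- csqrt z)) / complex_of_real (sqrt 2))"
  by (simp_all add: free_U_def free_S_def free_star_single word_star_def act_single word_op_def)

text \<open>By locality, the action is continuous for pointwise convergence.\<close>

lemma act_tendsto:
  assumes "\<And>z. (\<lambda>n. f n z) \<longlonglongrightarrow> g z"
  shows "(\<lambda>n. act a (f n) z) \<longlonglongrightarrow> act a g z"
proof -
  have l: "(\<lambda>n. letter_op l (h n) z) \<longlonglongrightarrow> letter_op l k z"
    if "\<And>z. (\<lambda>n. h n z) \<longlonglongrightarrow> k z" for l h k z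
    by (cases l) (auto intro!: tendsto_intros that)
  have "(\<lambda>n. word_op (Word ls) (f n) z) \<longlonglongrightarrow> word_op (Word ls) g z" for ls z
  proof (induction ls arbitrary: z)
    case Nil
    then show ?case using assms by (simp add: word_op_def)
  qed (simp add: word_op_Cons l)
  then have "(\<lambda>n. word_op w (f n) z) \<longlonglongrightarrow> word_op w g z" for w z
    by (cases w) simp
  then show ?thesis
    unfolding act_def by (intro tendsto_intros)
qed

lemma square_eq_iff_csqrt: "z\<^sup>2 = x \<longleftrightarrow> z = csqrt x \<or> z = - csqrt x"
  by (metis power2_csqrt power2_eq_iff)

section \<open>The pre-Hilbert space of finitely supported functions on the circle\<close>

definition circ_supported :: "(complex \<Rightarrow> complex) \<Rightarrow> bool" where
  "circ_supported f \<longleftrightarrow> finite {z. f z \<noteq> 0} \<and> (\<forall>z. f z \<noteq> 0 \<longrightarrow> cmod z = 1)"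

lemma circ_supported_add:
  "circ_supported f \<Longrightarrow> circ_supported g \<Longrightarrow> circ_supported (\<lambda>z. f z + g z)"
  unfolding circ_supported_def
  by (intro conjI finite_subset [of "{z. f z + g z \<noteq> 0}" "{z. f z \<noteq> 0} \<union> {z. g z \<noteq> 0}"])
    (auto, metis add_0)

lemma circ_supported_cmult: "circ_supported f \<Longrightarrow> circ_supported (\<lambda>z. c z * f z)"
  unfolding circ_supported_def by (auto elim!: rev_finite_subset)

lemma circ_supported_letter_op:
  assumes "circ_supported f"
  shows "circ_supported (letter_op l f)"
proof (cases l)
  case LS
  have "{z. f (z\<^sup>2) \<noteq> 0} \<subseteq> csqrt ` {z. f z \<noteq> 0} \<union> (\<lambda>z. - csqrt z) ` {z. f z \<noteq> 0}"
    using square_eq_iff_csqrt by blast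
  then have "finite {z. f (z\<^sup>2) \<noteq> 0}"
    using assms by (auto simp: circ_supported_def elim: finite_subset)
  moreover have "cmod z = 1" if "f (z\<^sup>2) \<noteq> 0" for z
  proof -
    have "(cmod z)\<^sup>2 = 1"
      using assms that by (auto simp: circ_supported_def simp flip: norm_power)
    then show ?thesis
      by (simp add: power2_eq_1_iff) (use norm_ge_zero [of z] in linarith)
  qed
  ultimately show ?thesis
    by (simp add: LS circ_supported_def)
next
  case LSs
  have n: "f (csqrt z) \<noteq> 0 \<or> f (- csqrt z) \<noteq> 0" if "f (csqrt z) + f (- csqrt z) \<noteq> 0" for z
    using that by auto
  have "{z. f (csqrt z) + f (- csqrt z) \<noteq> 0} \<subseteq> (\<lambda>z. z\<^sup>2) ` {z. f z \<noteq> 0}"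
  proof
    fix z assume "z \<in> {z. f (csqrt z) + f (- csqrt z) \<noteq> 0}"
    then show "z \<in> (\<lambda>z. z\<^sup>2) ` {z. f z \<noteq> 0}"
      using n [of z] by (auto intro: image_eqI [of _ _ "csqrt z"] image_eqI [of _ _ "- csqrt z"])
  qed
  then have "finite {z. f (csqrt z) + f (- csqrt z) \<noteq> 0}"
    using assms by (auto simp: circ_supported_def elim: finite_subset)
  moreover have "cmod z = 1" if "f (csqrt z) + f (- csqrt z) \<noteq> 0" for z
  proof -
    have "cmod (csqrt z) = 1"
      using n [OF that] assms by (auto simp: circ_supported_def)
    then have "cmod ((csqrt z)\<^sup>2) = 1"
      unfolding norm_power by simp
    then show ?thesis by simp
  qed
  ultimately show ?thesis
    by (simp add: LSs circ_supported_def)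
qed (use assms in \<open>simp_all add: circ_supported_cmult\<close>)

lemma circ_supported_act:
  assumes "circ_supported f"
  shows "circ_supported (act a f)"
proof -
  have "circ_supported (word_op (Word ls) f)" for ls
    by (induction ls) (simp_all add: word_op_Cons circ_supported_letter_op, simp add: word_op_def assms)
  then have "circ_supported (word_op w f)" for w
    by (cases w) simp
  then show ?thesis
    by (induction a rule: free_induct)
      (simp_all add: act_zero act_single act_add circ_supported_add circ_supported_cmult,
       simp add: circ_supported_def)
qed

text \<open>The scalars of \<open>real_inner\<close> are real; the inner product below is the real part of the usual
  complex one. It has the same norm and the same adjoints.\<close>

typedef circ_vec = "{f. circ_supported f}" morphisms coord Abs_circ_vec
  by (rule exI [of _ "\<lambda>_. 0"]) (simp add: circ_supported_def)

setup_lifting type_definition_circ_vec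

lemma circ_vec_eqI: "(\<And>z. coord f z = coord g z) \<Longrightarrow> f = g"
  by (simp add: coord_inject [symmetric] fun_eq_iff)

lemma coord_supported: "circ_supported (coord f)"
  using coord by simp

lemma finite_coord_support: "finite {z. coord f z \<noteq> 0}"
  using coord_supported by (auto simp: circ_supported_def)

lemma coord_off_circle: "cmod z \<noteq> 1 \<Longrightarrow> coord f z = 0"
  using coord_supported by (auto simp: circ_supported_def)

instantiation circ_vec :: real_inner
begin

lift_definition zero_circ_vec :: circ_vec is "\<lambda>_. 0"
  by (simp add: circ_supported_def)

lift_definition plus_circ_vec :: "circ_vec \<Rightarrow> circ_vec \<Rightarrow> circ_vec" is "\<lambda>f g z. f z + g z"
  by (rule circ_supported_add)

lift_definition uminus_circ_vec :: "circ_vec \<Rightarrow> circ_vec" is "\<lambda>f z. - f z"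
  by (simp add: circ_supported_def)

definition minus_circ_vec :: "circ_vec \<Rightarrow> circ_vec \<Rightarrow> circ_vec" where
  "minus_circ_vec f g = f + - g"

lift_definition scaleR_circ_vec :: "real \<Rightarrow> circ_vec \<Rightarrow> circ_vec" is "\<lambda>r f z. of_real r * f z"
  by (rule circ_supported_cmult)

definition inner_circ_vec :: "circ_vec \<Rightarrow> circ_vec \<Rightarrow> real" where
  "inner_circ_vec f g = (\<Sum>z | coord f z \<noteq> 0. inner (coord f z) (coord g z))"

definition norm_circ_vec :: "circ_vec \<Rightarrow> real" where "norm_circ_vec f = sqrt (inner f f)"

definition sgn_circ_vec :: "circ_vec \<Rightarrow> circ_vec" where "sgn_circ_vec f = inverse (norm f) *\<^sub>R f"

definition dist_circ_vec :: "circ_vec \<Rightarrow> circ_vec \<Rightarrow> real" where "dist_circ_vec f g = norm (f - g)"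

definition uniformity_circ_vec :: "(circ_vec \<times> circ_vec) filter" where
  "uniformity_circ_vec = (INF e\<in>{0 <..}. principal {(f, g). dist f g < e})"

definition open_circ_vec :: "circ_vec set \<Rightarrow> bool" where
  "open_circ_vec S \<longleftrightarrow> (\<forall>f\<in>S. \<forall>\<^sub>F (f', g) in uniformity. f' = f \<longrightarrow> g \<in> S)"

lemma inner_circ_vec_superset:
  assumes "finite A" "{z. coord f z \<noteq> 0} \<subseteq> A \<or> {z. coord g z \<noteq> 0} \<subseteq> A"
  shows "inner f g = (\<Sum>z\<in>A. inner (coord f z) (coord g z))"
proof -
  let ?I = "{z. coord f z \<noteq> 0}" and ?J = "{z. coord g z \<noteq> 0}"
  have "inner f g = (\<Sum>z\<in>?I \<union> A. inner (coord f z) (coord g z))"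
    unfolding inner_circ_vec_def
    by (rule sum.mono_neutral_left) (auto simp: assms finite_coord_support)
  also have "\<dots> = (\<Sum>z\<in>A. inner (coord f z) (coord g z))"
  proof (rule sum.mono_neutral_right)
    have "coord f z = 0 \<or> coord g z = 0" if "z \<notin> A" for z
      using that assms(2) by blast
    then show "\<forall>z\<in>(?I \<union> A) - A. inner (coord f z) (coord g z) = 0"
      by force
  qed (auto simp: assms finite_coord_support)
  finally show ?thesis .
qed

instance
proof
  fix f g h :: circ_vec and r q :: real
  let ?A = "{z. coord f z \<noteq> 0} \<union> {z. coord g z \<noteq> 0}"
  have A: "finite ?A"
    by (simp add: finite_coord_support)
  show "f + g + h = f + (g + h)" "f + g = g + f" "0 + f = f" "- f + f = 0" "f - g = f + - g"
    "r *\<^sub>R (f + g) = r *\<^sub>R f + r *\<^sub>R g" "(r + q) *\<^sub>R f = r *\<^sub>R f + q *\<^sub>R f"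
    "r *\<^sub>R q *\<^sub>R f = (r * q) *\<^sub>R f" "1 *\<^sub>R f = f"
    by (auto intro!: circ_vec_eqI simp: minus_circ_vec_def plus_circ_vec.rep_eq zero_circ_vec.rep_eq
        uminus_circ_vec.rep_eq scaleR_circ_vec.rep_eq algebra_simps)
  show "inner f g = inner g f"
    using inner_circ_vec_superset [OF A, of f g] inner_circ_vec_superset [OF A, of g f]
    by (simp add: inner_commute)
  have "inner f h = (\<Sum>z\<in>?A. inner (coord f z) (coord h z))"
    "inner g h = (\<Sum>z\<in>?A. inner (coord g z) (coord h z))"
    "inner (f + g) h = (\<Sum>z\<in>?A. inner (coord (f + g) z) (coord h z))"
    by (rule inner_circ_vec_superset [OF A disjI1]; force simp: plus_circ_vec.rep_eq)+
  then show "inner (f + g) h = inner f h + inner g h"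
    by (simp only: plus_circ_vec.rep_eq inner_add_left sum.distrib)
  show "inner (r *\<^sub>R f) g = r * inner f g"
    using inner_circ_vec_superset [OF A, of f g] inner_circ_vec_superset [OF A, of "r *\<^sub>R f" g]
    by (simp add: scaleR_circ_vec.rep_eq sum_distrib_left inner_complex_def algebra_simps subset_iff)
  show "0 \<le> inner f f"
    by (auto simp: inner_circ_vec_def intro!: sum_nonneg)
  show "inner f f = 0 \<longleftrightarrow> f = 0"
  proof
    assume "inner f f = 0"
    then have "\<forall>z\<in>{z. coord f z \<noteq> 0}. inner (coord f z) (coord f z) = 0"
      unfolding inner_circ_vec_def
      by (subst (asm) sum_nonneg_eq_0_iff) (simp_all add: finite_coord_support)
    then show "f = 0"
      by (auto intro!: circ_vec_eqI simp: zero_circ_vec.rep_eq)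
  qed (simp add: inner_circ_vec_def zero_circ_vec.rep_eq)
  show "norm f = sqrt (inner f f)" "sgn f = inverse (norm f) *\<^sub>R f" "dist f g = norm (f - g)"
    by (rule norm_circ_vec_def sgn_circ_vec_def dist_circ_vec_def)+
  show "uniformity = (INF e\<in>{0 <..}. principal {(f, g :: circ_vec). dist f g < e})"
    by (rule uniformity_circ_vec_def)
  show "open S \<longleftrightarrow> (\<forall>f\<in>S. \<forall>\<^sub>F (f', g) in uniformity. f' = f \<longrightarrow> g \<in> S)" for S :: "circ_vec set"
    by (rule open_circ_vec_def)
qed

end

lemma norm_circ_vec_sum:
  assumes "finite A" "{z. coord f z \<noteq> 0} \<subseteq> A"
  shows "norm f = sqrt (\<Sum>z\<in>A. (cmod (coord f z))\<^sup>2)"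
  using inner_circ_vec_superset [of A f f] assms
  by (simp only: norm_eq_sqrt_inner [of f] power2_norm_eq_inner simp_thms)

lemma norm_circ_vec_cmult:
  assumes "\<And>z. coord g z = c * coord f z"
  shows "norm g = cmod c * norm f"
proof -
  let ?A = "{z. coord f z \<noteq> 0}"
  have "norm g = sqrt (\<Sum>z\<in>?A. (cmod (coord g z))\<^sup>2)"
    by (rule norm_circ_vec_sum) (auto simp: assms finite_coord_support)
  also have "\<dots> = sqrt (\<Sum>z\<in>?A. (cmod c)\<^sup>2 * (cmod (coord f z))\<^sup>2)"
    by (simp only: assms norm_mult power_mult_distrib)
  also have "\<dots> = cmod c * sqrt (\<Sum>z\<in>?A. (cmod (coord f z))\<^sup>2)"
    by (simp only: sum_distrib_left [symmetric] real_sqrt_mult real_sqrt_abs abs_norm_cancel)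
  also have "\<dots> = cmod c * norm f"
    using norm_circ_vec_sum [OF finite_coord_support order_refl, of f] by simp
  finally show ?thesis .
qed

lemma cmod_coord_le: "cmod (coord f z) \<le> norm f"
proof -
  let ?A = "insert z {z. coord f z \<noteq> 0}"
  have A: "finite ?A" "{z. coord f z \<noteq> 0} \<subseteq> ?A"
    using finite_coord_support by blast+
  have "(cmod (coord f z))\<^sup>2 \<le> (\<Sum>z\<in>?A. (cmod (coord f z))\<^sup>2)"
    by (rule member_le_sum [where f = "\<lambda>z. (cmod (coord f z))\<^sup>2"]) (use A(1) in auto)
  then show ?thesis
    unfolding norm_circ_vec_sum [OF A] by (rule real_le_rsqrt)
qed

lift_definition circ_op :: "q2_free \<Rightarrow> circ_vec \<Rightarrow> circ_vec" is act
  by (rule circ_supported_act)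

lemma circ_op_mult: "circ_op (a * b) f = circ_op a (circ_op b f)"
  by (rule circ_vec_eqI) (simp add: circ_op.rep_eq act_mult)

lemma circ_op_add: "circ_op (a + b) f = circ_op a f + circ_op b f"
  by (rule circ_vec_eqI) (simp add: circ_op.rep_eq act_add plus_circ_vec.rep_eq)

lemma circ_op_one: "circ_op 1 f = f"
  by (rule circ_vec_eqI) (simp add: circ_op.rep_eq act_one)

text \<open>The point of the factor \<open>1 / sqrt 2\<close> in the action of \<open>S\<close> is that every point of the circle has
  two square roots, which makes \<open>S\<close> isometric. The range projections of \<open>S\<close> and \<open>U S\<close> are the
  projections onto the even and the odd functions.\<close>

lemma circ_op_relator:
  assumes "r \<in> q2_relators"
  shows "circ_op r f = 0"
proof (rule circ_vec_eqI)
  fix z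
  let ?s = "complex_of_real (sqrt 2)"
  have s: "?s * ?s = 2"
    by (simp flip: of_real_mult)
  have half: "(u / ?s + v / ?s) / ?s = (u + v) / 2" for u v
    by (simp only: s [symmetric] add_divide_distrib [symmetric] divide_divide_eq_left)
  have zz: "z * (cnj z * coord f z) = coord f z" "cnj z * (z * coord f z) = coord f z"
    using coord_off_circle [of z f] complex_norm_square [of z]
    by (cases "cmod z = 1"; simp add: mult.commute flip: mult.assoc)+
  have zz': "z * (cnj z * coord f (- z)) = coord f (- z)"
    using coord_off_circle [of "- z" f] complex_norm_square [of z]
    by (cases "cmod z = 1"; simp add: mult.commute flip: mult.assoc)
  have "csqrt (z\<^sup>2) = z \<or> csqrt (z\<^sup>2) = - z"
    using power2_eq_iff [of "csqrt (z\<^sup>2)" z] by simp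
  then have sum: "g (csqrt (z\<^sup>2)) + g (- csqrt (z\<^sup>2)) = g z + g (- z)" for g :: "complex \<Rightarrow> complex"
    by (auto simp: add.commute)
  have "act r (coord f) z = 0"
    using assms unfolding q2_relators_def
  proof (elim insertE emptyE)
    assume r: "r = free_star free_S * free_S - 1"
    have "(coord f ((csqrt z)\<^sup>2) / ?s + coord f ((- csqrt z)\<^sup>2) / ?s) / ?s = coord f z"
      by (simp only: half) simp
    then show ?thesis
      by (simp add: r act_diff act_mult act_one act_S act_S_star)
  next
    assume r: "r = free_S * free_star free_S + free_U * free_S * free_star free_S * free_star free_U - 1"
    have 1: "act (free_S * free_star free_S) g z = (g z + g (- z)) / 2" for g
      using sum [of g] s by (simp add: act_mult act_S act_S_star)
    have "act r (coord f) z = (coord f z + coord f (- z)) / 2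
        + z * ((cnj z * coord f z + cnj (- z) * coord f (- z)) / 2) - coord f z"
      by (simp add: r act_diff act_add 1 act_one act_U act_U_star mult.assoc act_mult [of free_U]
          act_mult [of "free_S * free_star free_S", unfolded mult.assoc] 1 [unfolded mult.assoc])
    also have "z * ((cnj z * coord f z + cnj (- z) * coord f (- z)) / 2)
        = (z * (cnj z * coord f z) - z * (cnj z * coord f (- z))) / 2"
      by (simp add: algebra_simps)
    also have "\<dots> = (coord f z - coord f (- z)) / 2"
      by (simp only: zz zz')
    finally show ?thesis
      by (simp add: field_simps)
  qed (simp_all add: act_diff act_mult act_one act_U act_S act_U_star zz power2_eq_square)
  then show "coord (circ_op r f) z = coord 0 z"
    by (simp add: circ_op.rep_eq zero_circ_vec.rep_eq)
qed

section \<open>The operator norm is one of the seminorms that define Q2\<close>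

lemma q2_free_gen_induct [case_names scalar U S star add mult]:
  assumes scalar: "\<And>c. P (Poly_Mapping.single 0 c)" and U: "P free_U" and S: "P free_S"
    and star: "\<And>a. P a \<Longrightarrow> P (free_star a)"
    and add: "\<And>a b. P a \<Longrightarrow> P b \<Longrightarrow> P (a + b)"
    and mult: "\<And>a b. P a \<Longrightarrow> P b \<Longrightarrow> P (a * b)"
  shows "P a"
proof (induction a rule: free_induct)
  case zero
  show ?case using scalar [of 0] by simp
next
  case (single w c)
  have letter: "P (Poly_Mapping.single (Word [l]) 1)" for l
    using U S star [OF U] star [OF S]
    by (cases l) (simp_all add: free_U_def free_S_def free_star_single word_star_def)
  have "P (Poly_Mapping.single (Word ls) c)" for ls
  proof (induction ls)
    case Nil
    show ?case using scalar [of c] by (simp add: zero_q2_word_def)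
  next
    case (Cons l ls)
    have "P (Poly_Mapping.single (Word [l]) 1 * Poly_Mapping.single (Word ls) c)"
      by (rule mult [OF letter Cons])
    then show ?case by (simp add: mult_single plus_q2_word_def)
  qed
  then show ?case by (cases w) simp
qed (rule add)

text \<open>Sum over the fibres of the squaring map: the points with square \<open>y\<close> are the two square roots of \<open>y\<close>,
  over which the adjoint of \<open>S\<close> sums.\<close>

lemma inner_circ_op_S: "inner (circ_op free_S g) f = inner g (circ_op (free_star free_S) f)"
proof -
  let ?A = "{z. coord g z \<noteq> 0}" and ?B = "{z. coord (circ_op free_S g) z \<noteq> 0}"
  let ?s = "complex_of_real (sqrt 2)"
  have move: "inner (u / ?s) v = inner u (v / ?s)" for u v
    by (simp add: inner_complex_def)
  let ?h = "\<lambda>z. inner (coord g (z\<^sup>2) / ?s) (coord f z)"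
  have "inner (circ_op free_S g) f = sum ?h ?B"
    by (simp add: inner_circ_vec_def circ_op.rep_eq act_S)
  also have "\<dots> = (\<Sum>y\<in>?A. \<Sum>z | z \<in> ?B \<and> z\<^sup>2 = y. ?h z)"
  proof (rule sum.group [symmetric])
    show "finite ?A" "finite ?B"
      by (rule finite_coord_support)+
    show "(\<lambda>z. z\<^sup>2) ` ?B \<subseteq> ?A"
      by (auto simp: circ_op.rep_eq act_S)
  qed
  also have "\<dots> = (\<Sum>y\<in>?A. inner (coord g y) (coord (circ_op (free_star free_S) f) y))"
  proof (rule sum.cong [OF refl])
    fix y assume y: "y \<in> ?A"
    then have "y \<noteq> 0"
      using coord_off_circle [of y g] by auto
    then have "csqrt y \<noteq> - csqrt y"
      by simp
    moreover have "{z. z \<in> ?B \<and> z\<^sup>2 = y} = {csqrt y, - csqrt y}"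
      using y square_eq_iff_csqrt by (auto simp: circ_op.rep_eq act_S)
    ultimately show "(\<Sum>z | z \<in> ?B \<and> z\<^sup>2 = y. ?h z)
        = inner (coord g y) (coord (circ_op (free_star free_S) f) y)"
      using y by (simp add: circ_op.rep_eq act_S_star add_divide_distrib inner_add_right move)
  qed
  also have "\<dots> = inner g (circ_op (free_star free_S) f)"
    by (simp add: inner_circ_vec_def)
  finally show ?thesis .
qed

lemma circ_op_adjoint: "inner (circ_op (free_star a) f) g = inner f (circ_op a g)"
proof (induction a arbitrary: f g rule: q2_free_gen_induct)
  case (scalar c)
  have "inner (circ_op (Poly_Mapping.single 0 d) f) g = (\<Sum>z | coord f z \<noteq> 0. inner (d * coord f z) (coord g z))"
    for d f g
    by (subst inner_circ_vec_superset [OF finite_coord_support])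
      (auto simp: circ_op.rep_eq act_single word_op_zero)
  then show ?case
    unfolding inner_circ_vec_def [of f]
    by (auto simp: free_star_single circ_op.rep_eq act_single word_op_zero inner_complex_def algebra_simps
        intro!: sum.cong)
next
  case U
  have "inner (circ_op (free_star free_U) f) g = (\<Sum>z | coord f z \<noteq> 0. inner (cnj z * coord f z) (coord g z))"
    by (subst inner_circ_vec_superset [OF finite_coord_support])
      (auto simp: circ_op.rep_eq act_U_star)
  then show ?case
    unfolding inner_circ_vec_def [of f]
    by (auto simp: circ_op.rep_eq act_U inner_complex_def algebra_simps intro!: sum.cong)
next
  case S
  show ?case using inner_circ_op_S by (simp add: inner_commute)
next
  case (star a)
  then show ?case by (metis free_star_star inner_commute)
next
  case (add a b)
  then show ?case by (simp add: free_star_add circ_op_add inner_add_left inner_add_right)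
next
  case (mult a b)
  then show ?case by (simp add: free_star_mult circ_op_mult)
qed

lemma norm_circ_op_isometry:
  assumes "free_star a * a - 1 \<in> q2_relators"
  shows "norm (circ_op a f) = norm f"
proof -
  have "(norm (circ_op a f))\<^sup>2 = inner f (circ_op (free_star a * a) f)"
    using circ_op_adjoint [of a "circ_op a f" f] by (simp add: power2_norm_eq_inner circ_op_mult inner_commute)
  also have "circ_op (free_star a * a) f = f"
    using circ_op_relator [OF assms, of f] circ_op_add [of "free_star a * a - 1" 1 f] by (simp add: circ_op_one)
  finally show ?thesis
    by (simp flip: power2_norm_eq_inner)
qed

text \<open>A bound for an operator is also a bound for its adjoint, by the Cauchy-Schwarz inequality, so
  that it suffices to bound the two generators, which are isometric.\<close>

lemma norm_circ_op_bound: "\<exists>C. \<forall>f. norm (circ_op a f) \<le> C * norm f"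
proof (induction a rule: q2_free_gen_induct)
  case (scalar c)
  have "norm (circ_op (Poly_Mapping.single 0 c) f) = cmod c * norm f" for f
    by (rule norm_circ_vec_cmult) (simp add: circ_op.rep_eq act_single word_op_zero)
  then show ?case by (metis order_refl)
next
  case U
  have "norm (circ_op free_U f) \<le> 1 * norm f" for f
    by (simp add: norm_circ_op_isometry q2_relators_def)
  then show ?case by blast
next
  case S
  have "norm (circ_op free_S f) \<le> 1 * norm f" for f
    by (simp add: norm_circ_op_isometry q2_relators_def)
  then show ?case by blast
next
  case (star a)
  then obtain C where C: "\<And>f. norm (circ_op a f) \<le> C * norm f" by blast
  have "norm (circ_op (free_star a) f) \<le> C * norm f" for f
  proof (cases "circ_op (free_star a) f = 0")
    case True
    then show ?thesis
      using order_trans [OF norm_ge_zero C [of f]] by simp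
  next
    case False
    let ?g = "circ_op (free_star a) f"
    have "norm ?g * norm ?g = inner f (circ_op a ?g)"
      using circ_op_adjoint [of a f ?g] by (simp add: power2_norm_eq_inner flip: power2_eq_square)
    also have "\<dots> \<le> norm f * (C * norm ?g)"
      by (rule order_trans [OF norm_cauchy_schwarz mult_left_mono]) (simp_all add: C)
    finally have "norm ?g * norm ?g \<le> (C * norm f) * norm ?g"
      by (simp add: mult_ac)
    then show ?thesis
      using False by simp
  qed
  then show ?case by blast
next
  case (add a b)
  then obtain C D where "\<And>f. norm (circ_op a f) \<le> C * norm f" "\<And>f. norm (circ_op b f) \<le> D * norm f" by blast
  then have "norm (circ_op (a + b) f) \<le> (C + D) * norm f" for f
    unfolding circ_op_add distrib_right by (intro order_trans [OF norm_triangle_ineq add_mono])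
  then show ?case by blast
next
  case (mult a b)
  then obtain C D where C: "\<And>f. norm (circ_op a f) \<le> C * norm f" and D: "\<And>f. norm (circ_op b f) \<le> D * norm f"
    by blast
  have "norm (circ_op (a * b) f) \<le> (\<bar>C\<bar> * D) * norm f" for f
  proof -
    have "norm (circ_op (a * b) f) \<le> C * norm (circ_op b f)"
      by (simp add: circ_op_mult C)
    also have "\<dots> \<le> \<bar>C\<bar> * norm (circ_op b f)"
      by (intro mult_right_mono) auto
    also have "\<dots> \<le> \<bar>C\<bar> * (D * norm f)"
      by (intro mult_left_mono D) auto
    finally show ?thesis by (simp add: mult.assoc)
  qed
  then show ?case by blast
qed

lemma bounded_linear_circ_op: "bounded_linear (circ_op a)"
proof -
  obtain C where "\<And>f. norm (circ_op a f) \<le> C * norm f"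
    using norm_circ_op_bound by blast
  moreover have "circ_op a (f + g) = circ_op a f + circ_op a g" "circ_op a (r *\<^sub>R f) = r *\<^sub>R circ_op a f" for f g r
    using act_linear [of a 1 "coord f" 1 "coord g"]
    by (auto intro!: circ_vec_eqI simp: circ_op.rep_eq plus_circ_vec.rep_eq scaleR_circ_vec.rep_eq act_cmult)
  ultimately show ?thesis
    by (intro bounded_linear_intro [of _ C]) (simp_all add: mult.commute)
qed

text \<open>The usual argument: \<open>\<parallel>a f\<parallel>\<^sup>2 = \<langle>f, a\<^sup>* a f\<rangle>\<close> and the Cauchy-Schwarz inequality bound the square of the
  norm of \<open>a\<close> by the norm of \<open>a\<^sup>* a\<close>. Submultiplicativity then gives \<open>\<parallel>a\<^sup>*\<parallel> \<le> \<parallel>a\<parallel>\<close> and the other inequality.\<close>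

lemma onorm_circ_op_cstar: "onorm (circ_op (free_star a * a)) = (onorm (circ_op a))\<^sup>2"
proof -
  let ?p = "\<lambda>a. onorm (circ_op a)"
  note bl = bounded_linear_circ_op
  have mult: "?p (a * b) \<le> ?p a * ?p b" for a b
    using onorm_compose [OF bl bl, of a b] by (simp add: o_def flip: circ_op_mult)
  have sq: "(?p a)\<^sup>2 \<le> ?p (free_star a * a)" for a
  proof -
    have "?p a \<le> sqrt (?p (free_star a * a))"
    proof (rule onorm_bound)
      fix f
      have "(norm (circ_op a f))\<^sup>2 = inner f (circ_op (free_star a * a) f)"
        using circ_op_adjoint [of a "circ_op a f" f] by (simp add: power2_norm_eq_inner circ_op_mult inner_commute)
      also have "\<dots> \<le> norm f * (?p (free_star a * a) * norm f)"
        by (rule order_trans [OF norm_cauchy_schwarz mult_left_mono]) (simp_all add: onorm [OF bl])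
      also have "\<dots> = (sqrt (?p (free_star a * a)) * norm f)\<^sup>2"
        using onorm_pos_le [OF bl, of "free_star a * a"] by (simp add: power_mult_distrib power2_eq_square)
      finally show "norm (circ_op a f) \<le> sqrt (?p (free_star a * a)) * norm f"
        using onorm_pos_le [OF bl, of "free_star a * a"] by (simp add: power2_le_iff_abs_le)
    qed (simp add: onorm_pos_le [OF bl])
    then have "(?p a)\<^sup>2 \<le> (sqrt (?p (free_star a * a)))\<^sup>2"
      by (intro power_mono onorm_pos_le [OF bl])
    then show ?thesis
      by (simp add: onorm_pos_le [OF bl])
  qed
  have star: "?p (free_star a) \<le> ?p a" for a
  proof (cases "?p (free_star a) = 0")
    case False
    have "?p (free_star a) * ?p (free_star a) \<le> ?p a * ?p (free_star a)"
      using sq [of "free_star a"] mult [of a "free_star a"] by (simp add: free_star_star power2_eq_square)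
    then show ?thesis
      using False onorm_pos_le [OF bl, of "free_star a"] by simp
  qed (simp add: onorm_pos_le [OF bl])
  have "?p (free_star a * a) \<le> ?p a * ?p a"
    by (rule order_trans [OF mult mult_right_mono]) (simp_all add: star onorm_pos_le [OF bl])
  with sq [of a] show ?thesis
    by (simp add: power2_eq_square)
qed

lemma onorm_circ_op_in_q2_seminorms: "(\<lambda>a. onorm (circ_op a)) \<in> q2_seminorms"
  unfolding q2_seminorms_def cstar_seminorm_def
proof (intro CollectI conjI allI ballI)
  note bl = bounded_linear_circ_op
  show "onorm (circ_op (a + b)) \<le> onorm (circ_op a) + onorm (circ_op b)" for a b
    using onorm_triangle [OF bl bl, of a b] by (simp flip: circ_op_add)
  show "onorm (circ_op (a * b)) \<le> onorm (circ_op a) * onorm (circ_op b)" for a b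
    using onorm_compose [OF bl bl, of a b] by (simp add: o_def flip: circ_op_mult)
  show "onorm (circ_op (free_star a * a)) = (onorm (circ_op a))\<^sup>2" for a
    by (rule onorm_circ_op_cstar)
  show "onorm (circ_op (free_scale c a)) = cmod c * onorm (circ_op a)" for c a
  proof -
    have "norm (circ_op (free_scale c a) f) = cmod c * norm (circ_op a f)" for f
      by (rule norm_circ_vec_cmult) (simp add: circ_op.rep_eq act_scale)
    then have "onorm (circ_op (free_scale c a)) = onorm (\<lambda>f. cmod c *\<^sub>R circ_op a f)"
      by (simp add: onorm_def)
    then show ?thesis
      by (simp add: onorm_scaleR [OF bl])
  qed
  show "onorm (circ_op r) = 0" if "r \<in> q2_relators" for r
    using that by (simp add: onorm_eq_0 [OF bl] circ_op_relator)
qed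

section \<open>Matrix coefficients of elements of Q2\<close>

text \<open>The basis vector at \<open>y\<close>, with the value \<open>0\<close> for \<open>y\<close> off the circle. With this convention the
  formulas for the columns hold for all complex \<open>y\<close>.\<close>

lift_definition delta :: "complex \<Rightarrow> circ_vec" is "\<lambda>y z. if z = y \<and> cmod y = 1 then 1 else 0"
  by (auto simp: circ_supported_def elim!: finite_subset [rotated, of "{_}"])

lemma norm_delta_le: "norm (delta y) \<le> 1"
proof -
  have "{z. coord (delta y) z \<noteq> 0} \<subseteq> {y}"
    by (auto simp: delta.rep_eq)
  then show ?thesis
    using norm_circ_vec_sum [of "{y}" "delta y"] by (simp add: delta.rep_eq)
qed

lemma coord_circ_op_delta_le: "cmod (coord (circ_op a (delta y)) x) \<le> q2_unorm a"
proof -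
  have "cmod (coord (circ_op a (delta y)) x) \<le> norm (circ_op a (delta y))"
    by (rule cmod_coord_le)
  also have "\<dots> \<le> onorm (circ_op a) * norm (delta y)"
    by (rule onorm [OF bounded_linear_circ_op])
  also have "\<dots> \<le> onorm (circ_op a)"
    by (rule mult_left_le [OF norm_delta_le onorm_pos_le [OF bounded_linear_circ_op]])
  also have "\<dots> \<le> q2_unorm a"
    using sn_le_unorm [OF onorm_circ_op_in_q2_seminorms] .
  finally show ?thesis .
qed

text \<open>The coefficient of \<open>T\<close> in column \<open>y\<close> and row \<open>x\<close>, computed along a sequence in the free algebra
  that represents \<open>T\<close>; \<open>column_Abs\<close> shows that the choice of the sequence does not matter.\<close>

definition q2_column :: "complex \<Rightarrow> Q2 \<Rightarrow> complex \<Rightarrow> complex" where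
  "q2_column y T x = lim (\<lambda>n. act (rep_Q2 T n) (coord (delta y)) x)"

lemma cmod_act_delta_diff_le:
  "cmod (act a (coord (delta y)) x - act b (coord (delta y)) x) \<le> q2_unorm (a - b)"
  using coord_circ_op_delta_le [of "a - b" y x] by (simp add: circ_op.rep_eq act_diff)

lemma column_Abs:
  assumes X: "q2_cauchy X"
  shows "(\<lambda>n. act (X n) (coord (delta y)) x) \<longlonglongrightarrow> q2_column y (Abs_Q2 X) x"
proof -
  let ?m = "\<lambda>a. act a (coord (delta y)) x"
  let ?R = "rep_Q2 (Abs_Q2 X)"
  have "q2_rel ?R X"
    using Quotient3_rep_abs [OF Quotient3_Q2, of X] X by (simp add: q2_rel_refl_iff)
  then have R: "q2_cauchy ?R" and d: "(\<lambda>n. q2_unorm (X n - ?R n)) \<longlonglongrightarrow> 0"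
    by (auto simp: q2_rel_def unorm_diff_commute)
  have "Cauchy (\<lambda>n. ?m (?R n))"
  proof (rule CauchyI)
    fix e :: real assume "e > 0"
    then show "\<exists>N. \<forall>m\<ge>N. \<forall>n\<ge>N. norm (?m (?R m) - ?m (?R n)) < e"
      using R cmod_act_delta_diff_le unfolding q2_cauchy_def by (meson le_less_trans)
  qed
  then have "(\<lambda>n. ?m (?R n)) \<longlonglongrightarrow> q2_column y (Abs_Q2 X) x"
    unfolding q2_column_def by (rule convergent_LIMSEQ_iff [THEN iffD1, OF Cauchy_convergent])
  then show ?thesis
  proof (rule Lim_transform)
    show "(\<lambda>n. ?m (X n) - ?m (?R n)) \<longlonglongrightarrow> 0"
      by (rule Lim_null_comparison [OF _ d]) (simp add: cmod_act_delta_diff_le)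
  qed
qed

lemma column_emb: "q2_column y (q2_emb a) = act a (coord (delta y))"
  using column_Abs [of "\<lambda>_. a"] by (auto simp: q2_emb_def LIMSEQ_const_iff)

lemma column_one: "q2_column y 1 = coord (delta y)"
  using column_emb [of y 1] by (simp add: q2_emb_simps act_one)

lemma column_lipschitz: "cmod (q2_column y T x - q2_column y T' x) \<le> norm (T - T')"
proof (induct T, induct T')
  case (Abs Y X)
  have "(\<lambda>n. cmod (act (X n) (coord (delta y)) x - act (Y n) (coord (delta y)) x))
      \<longlonglongrightarrow> cmod (q2_column y (Abs_Q2 X) x - q2_column y (Abs_Q2 Y) x)"
    using Abs by (intro tendsto_norm tendsto_diff column_Abs)
  moreover have "(\<lambda>n. q2_unorm (X n - Y n)) \<longlonglongrightarrow> norm (Abs_Q2 X - Abs_Q2 Y)"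
    using Abs by (simp add: Abs_Q2_simps norm_Abs_Q2_tendsto)
  ultimately show ?case
    by (rule LIMSEQ_le) (simp add: cmod_act_delta_diff_le)
qed

lemma continuous_on_column [continuous_intros]:
  assumes "continuous_on A f"
  shows "continuous_on A (\<lambda>s. q2_column y (f s) x)"
proof -
  have "1-lipschitz_on UNIV (\<lambda>T. q2_column y T x)"
    by (rule lipschitz_onI) (simp_all add: dist_norm column_lipschitz)
  then show ?thesis
    using assms by (rule continuous_on_compose2 [OF lipschitz_on_continuous_on]) auto
qed

text \<open>Left multiplication by the free algebra is the action on columns, although \<open>q2_column y T\<close> may
  have infinite support: the action passes to the pointwise limit by \<open>act_tendsto\<close>.\<close>

lemma column_emb_mult: "q2_column y (q2_emb a * T) = act a (q2_column y T)"
proof (induct T)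
  case (Abs X)
  show ?case
  proof
    fix x
    have "(\<lambda>n. act a (act (X n) (coord (delta y))) x) \<longlonglongrightarrow> act a (q2_column y (Abs_Q2 X)) x"
      by (intro act_tendsto column_Abs Abs)
    moreover have "(\<lambda>n. act (a * X n) (coord (delta y)) x) \<longlonglongrightarrow> q2_column y (q2_emb a * Abs_Q2 X) x"
      using column_Abs [of "\<lambda>n. a * X n" y x] Abs by (simp add: q2_emb_def Abs_Q2_simps)
    ultimately show "q2_column y (q2_emb a * Abs_Q2 X) x = act a (q2_column y (Abs_Q2 X)) x"
      by (simp add: act_mult LIMSEQ_unique)
  qed
qed

lemma Q2_eq_by_density:
  fixes F G :: "Q2 \<Rightarrow> complex"
  assumes "continuous_on UNIV F" "continuous_on UNIV G" "\<And>a. F (q2_emb a) = G (q2_emb a)"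
  shows "F T = G T"
proof (induct T)
  case (Abs X)
  have "(\<lambda>n. H (q2_emb (X n))) \<longlonglongrightarrow> H (Abs_Q2 X)" if "continuous_on UNIV H" for H :: "Q2 \<Rightarrow> complex"
    using continuous_on_tendsto_compose [OF that q2_emb_tendsto [OF Abs]] by simp
  from this [OF assms(1)] this [OF assms(2)] show ?case
    by (simp add: assms(3) LIMSEQ_unique)
qed

lemma column_mult_U: "q2_column y (T * q2_U) x = y * q2_column y T x"
proof (rule Q2_eq_by_density [of _ _ T])
  have "act free_U (coord (delta y)) = (\<lambda>z. y * coord (delta y) z)"
    by (auto simp: act_U delta.rep_eq)
  then show "q2_column y (q2_emb a * q2_U) x = y * q2_column y (q2_emb a) x" for a
    by (simp add: q2_U_def column_emb act_mult act_cmult flip: q2_emb_simps)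
qed (intro continuous_intros)+

text \<open>The image of the basis vector at \<open>y\<close> under \<open>S\<close> is the sum of the basis vectors at the two square
  roots of \<open>y\<close>, divided by \<open>sqrt 2\<close>.\<close>

lemma column_mult_S:
  "q2_column y (T * q2_S) x = (q2_column (csqrt y) T x + q2_column (- csqrt y) T x) / complex_of_real (sqrt 2)"
proof (rule Q2_eq_by_density [of _ _ T])
  let ?c = "1 / complex_of_real (sqrt 2)"
  have "cmod (csqrt y) = 1 \<longleftrightarrow> cmod y = 1"
    using norm_power [of "csqrt y" 2] norm_ge_zero [of "csqrt y"] by (auto simp: power2_eq_1_iff)
  moreover have "csqrt y \<noteq> - csqrt y" if "y \<noteq> 0"
    using that by simp
  moreover have "y \<noteq> 0" if "cmod y = 1"
    using that by auto
  ultimately have "act free_S (coord (delta y)) z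
      = ?c * coord (delta (csqrt y)) z + ?c * coord (delta (- csqrt y)) z" for z
    using square_eq_iff_csqrt [of z y] by (cases "cmod y = 1") (auto simp: act_S delta.rep_eq)
  then have "act free_S (coord (delta y))
      = (\<lambda>z. ?c * coord (delta (csqrt y)) z + ?c * coord (delta (- csqrt y)) z)" ..
  then show "q2_column y (q2_emb a * q2_S) x
      = (q2_column (csqrt y) (q2_emb a) x + q2_column (- csqrt y) (q2_emb a) x) / complex_of_real (sqrt 2)"
    for a
    by (simp only: q2_S_def q2_emb_simps(3) [symmetric] column_emb act_mult act_linear)
      (simp add: add_divide_distrib)
qed (auto intro!: continuous_intros)

lemma column_U_mult: "q2_column y (q2_U * T) x = x * q2_column y T x"
  by (simp add: q2_U_def column_emb_mult act_U)

lemma column_S_mult: "q2_column y (q2_S * T) x = q2_column y T (x\<^sup>2) / complex_of_real (sqrt 2)"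
  by (simp add: q2_S_def column_emb_mult act_S)

section \<open>Elements commuting with U, and the coboundary equation\<close>

text \<open>Comparing \<open>w U\<close> and \<open>U w\<close> in row \<open>x\<close> and column \<open>y\<close> gives \<open>(x - y) w\<^sub>x\<^sub>y = 0\<close>.\<close>

lemma column_commuting_U:
  assumes "w * q2_U = q2_U * w"
  shows "q2_column y w = (\<lambda>x. q2_column y w y * coord (delta y) x)"
proof
  fix x
  have "q2_column y w x = 0" if "x \<noteq> y"
    using column_mult_U [of y w x] column_U_mult [of y w x] assms that by simp
  moreover have "q2_column y w x = 0" if "cmod y \<noteq> 1" for x
  proof -
    have "delta y = 0"
      using that by (intro circ_vec_eqI) (simp add: delta.rep_eq zero_circ_vec.rep_eq)
    then show ?thesis
      by (induct w) (use column_Abs [of _ y x] act_cmult [of _ 0] in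
        \<open>auto simp: zero_circ_vec.rep_eq LIMSEQ_const_iff\<close>)
  qed
  ultimately show "q2_column y w x = q2_column y w y * coord (delta y) x"
    by (auto simp: delta.rep_eq)
qed

text \<open>Since \<open>w\<close> is diagonal, the diagonal coefficients of \<open>T w\<close> are the products of those of \<open>T\<close> and
  \<open>w\<close>; apply this to \<open>T = star w\<close>.\<close>

lemma column_diagonal_nonzero:
  assumes "w * q2_U = q2_U * w" "unitary_elt w" "cmod y = 1"
  shows "q2_column y w y \<noteq> 0"
proof -
  have "q2_column y (T * w) y = q2_column y w y * q2_column y T y" for T
  proof (rule Q2_eq_by_density [of _ _ T])
    show "q2_column y (q2_emb a * w) y = q2_column y w y * q2_column y (q2_emb a) y" for a
      unfolding column_emb_mult column_emb
      by (subst column_commuting_U [OF assms(1)]) (simp add: act_cmult)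
  qed (intro continuous_intros)+
  from this [of "star w"] show ?thesis
    using assms(2,3) by (auto simp: unitary_elt_def column_one delta.rep_eq)
qed

text \<open>Compare the coefficients in row \<open>y\<close> and column \<open>y\<^sup>2\<close>. Of the two terms in the column of \<open>w S\<close> only
  the one for the square root \<open>y\<close> of \<open>y\<^sup>2\<close> meets row \<open>y\<close>.\<close>

lemma diagonal_cocycle:
  assumes w: "w * q2_U = q2_U * w" and y: "cmod y = 1"
    and eq: "q2_emb a * (w * q2_S) = q2_emb b * (q2_S * w)"
    and a: "\<And>f z. act a f z = \<alpha> z * f z" and b: "\<And>f z. act b f z = \<beta> z * f z"
  shows "\<alpha> y * q2_column y w y = \<beta> y * q2_column (y\<^sup>2) w (y\<^sup>2)"
proof -
  let ?c = "csqrt (y\<^sup>2)"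
  have d: "q2_column u w v = 0" if "u \<noteq> v" for u v
    by (rule trans [OF fun_cong [OF column_commuting_U [OF w]]]) (use that in \<open>simp add: delta.rep_eq\<close>)
  have "y \<noteq> 0" using y by auto
  then have "y \<noteq> - y" by simp
  moreover have "?c = y \<or> ?c = - y"
    using power2_eq_iff [of ?c y] by simp
  ultimately have "q2_column ?c w y + q2_column (- ?c) w y = q2_column y w y"
    using d [of "- y" y] by auto
  then have "q2_column (y\<^sup>2) (q2_emb a * (w * q2_S)) y = \<alpha> y * q2_column y w y / complex_of_real (sqrt 2)"
    by (simp add: column_emb_mult a column_mult_S)
  moreover have "q2_column (y\<^sup>2) (q2_emb b * (q2_S * w)) y = \<beta> y * q2_column (y\<^sup>2) w (y\<^sup>2) / complex_of_real (sqrt 2)"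
    by (simp add: column_emb_mult b column_S_mult)
  ultimately show ?thesis
    using eq by simp
qed

section \<open>A periodic orbit of the squaring map\<close>

text \<open>For \<open>\<sigma> = \<zeta> + \<zeta>\<^sup>2 + \<zeta>\<^sup>4\<close> one has \<open>\<sigma> + cnj \<sigma> = -1\<close> and \<open>\<sigma> * cnj \<sigma> = 2\<close>, so the real part of
  \<open>\<sigma>\<close> is \<open>-1/2\<close> and the imaginary part is \<open>\<plusminus> sqrt 7 / 2\<close>. The product \<open>F\<close> of the \<open>1 - z / 2\<close> over the orbit
  is \<open>1 - \<sigma> / 2 + cnj \<sigma> / 4 - 1 / 8\<close>, which has real part \<open>1\<close> and nonzero imaginary part; hence
  \<open>F\<^sup>2\<close> is not real.\<close>

lemma seventh_root_of_unity_product: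
  obtains \<zeta> :: complex where "cmod \<zeta> = 1" "\<zeta> ^ 8 = \<zeta>"
    "((1 - \<zeta> / 2) * (1 - \<zeta>\<^sup>2 / 2) * (1 - \<zeta> ^ 4 / 2))\<^sup>2
      \<noteq> (cnj ((1 - \<zeta> / 2) * (1 - \<zeta>\<^sup>2 / 2) * (1 - \<zeta> ^ 4 / 2)))\<^sup>2"
proof
  define \<zeta> where "\<zeta> = cis (2 * pi / 7)"
  define \<sigma> where "\<sigma> = \<zeta> + \<zeta>\<^sup>2 + \<zeta> ^ 4"
  let ?F = "(1 - \<zeta> / 2) * (1 - \<zeta>\<^sup>2 / 2) * (1 - \<zeta> ^ 4 / 2)"
  show norm: "cmod \<zeta> = 1"
    by (simp add: \<zeta>_def)
  have p7: "\<zeta> ^ 7 = 1"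
    unfolding \<zeta>_def Complex.DeMoivre by simp
  have red: "\<zeta> ^ (k + 7) = \<zeta> ^ k" for k
    by (simp add: power_add p7)
  show "\<zeta> ^ 8 = \<zeta>"
    using red [of 1] by simp
  have "sin (2 * pi / 7) > 0"
    by (rule sin_gt_zero) auto
  then have "Im \<zeta> \<noteq> 0"
    by (simp add: \<zeta>_def)
  then have "\<zeta> \<noteq> 1"
    by auto
  moreover have "(\<zeta> - 1) * (1 + \<zeta> + \<zeta>\<^sup>2 + \<zeta> ^ 3 + \<zeta> ^ 4 + \<zeta> ^ 5 + \<zeta> ^ 6) = \<zeta> ^ 7 - 1"
    by (simp add: algebra_simps eval_nat_numeral)
  ultimately have cyclotomic: "1 + \<zeta> + \<zeta>\<^sup>2 + \<zeta> ^ 3 + \<zeta> ^ 4 + \<zeta> ^ 5 + \<zeta> ^ 6 = 0"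
    by (simp add: p7)
  have "\<zeta> * cnj \<zeta> = 1"
    using norm complex_norm_square [of \<zeta>] by simp
  moreover have "\<zeta> * \<zeta> ^ 6 = 1"
    using p7 by (simp flip: power_Suc)
  ultimately have "cnj \<zeta> = \<zeta> ^ 6"
    by (metis mult_left_cancel mult_zero_left zero_neq_one)
  then have cnj_\<sigma>: "cnj \<sigma> = \<zeta> ^ 3 + \<zeta> ^ 5 + \<zeta> ^ 6"
    using red [of 5] red [of 3] red [of 10] red [of 17] by (simp add: \<sigma>_def power_mult [symmetric])
  have re: "\<sigma> + cnj \<sigma> = -1"
    using cyclotomic unfolding cnj_\<sigma> unfolding \<sigma>_def by (simp add: algebra_simps add_eq_0_iff)
  have "\<sigma> * cnj \<sigma> = 3 * \<zeta> ^ 7 + \<zeta> ^ 4 + \<zeta> ^ 6 + \<zeta> ^ 5 + \<zeta> ^ 8 + \<zeta> ^ 9 + \<zeta> ^ 10"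
    unfolding cnj_\<sigma> unfolding \<sigma>_def by (simp add: algebra_simps flip: power_add power_Suc power_Suc2)
  also have "\<dots> = 2 + (1 + \<zeta> + \<zeta>\<^sup>2 + \<zeta> ^ 3 + \<zeta> ^ 4 + \<zeta> ^ 5 + \<zeta> ^ 6)"
    using red [of 1] red [of 2] red [of 3] by (simp add: p7)
  finally have im: "\<sigma> * cnj \<sigma> = 2"
    by (simp add: cyclotomic)
  have Re: "Re \<sigma> = - 1 / 2"
    using re by (simp add: complex_eq_iff)
  have "(Re \<sigma>)\<^sup>2 + (Im \<sigma>)\<^sup>2 = 2"
    using im by (simp add: complex_eq_iff power2_eq_square)
  then have Im: "Im \<sigma> \<noteq> 0"
    by (auto simp: Re power2_eq_square)
  have "?F = 1 - \<sigma> / 2 + cnj \<sigma> / 4 - \<zeta> ^ 7 / 8"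
    unfolding cnj_\<sigma> unfolding \<sigma>_def by (simp add: field_simps flip: power_add power_Suc power_Suc2)
  then have F: "?F = 1 - \<sigma> / 2 + cnj \<sigma> / 4 - 1 / 8"
    by (simp add: p7)
  have Re_Im: "Re ?F = 1" "Im ?F = - 3 / 4 * Im \<sigma>"
    unfolding F by (simp_all add: Re)
  have sq: "G\<^sup>2 \<noteq> (cnj G)\<^sup>2" if "Re G \<noteq> 0" "Im G \<noteq> 0" for G
    unfolding power2_eq_iff using that by (auto simp: complex_eq_iff)
  show "?F\<^sup>2 \<noteq> (cnj ?F)\<^sup>2"
    by (rule sq) (simp_all only: Re_Im, simp_all add: Im)
qed

definition one_minus_half_U :: q2_free where
  "one_minus_half_U = 1 - free_scale (1 / 2) free_U"

lemma act_one_minus_half_U: "act one_minus_half_U f = (\<lambda>z. (1 - z / 2) * f z)"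
  and act_star_one_minus_half_U: "act (free_star one_minus_half_U) f = (\<lambda>z. cnj (1 - z / 2) * f z)"
  by (simp_all add: one_minus_half_U_def act_diff act_one act_scale act_U act_U_star free_star_diff
      free_scale_star fun_eq_iff algebra_simps)

text \<open>In terms of the diagonal \<open>h\<close> of \<open>w\<close>, equality would mean
  \<open>(1 - y / 2)\<^sup>2 h(y\<^sup>2) = (1 - cnj y / 2)\<^sup>2 h(y)\<close> on the circle. Along the orbit \<open>\<zeta>, \<zeta>\<^sup>2, \<zeta>\<^sup>4\<close> the
  same factors \<open>h\<close> occur on both sides, and they cancel.\<close>

lemma no_diagonal_intertwiner:
  assumes w: "unitary_elt w" and wU: "w * q2_U = q2_U * w" and t: "t = q2_emb one_minus_half_U"
  shows "t * t * (q2_S * w) \<noteq> star t * star t * (w * q2_S)"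
proof
  let ?tf = one_minus_half_U
  assume "t * t * (q2_S * w) = star t * star t * (w * q2_S)"
  then have eq: "q2_emb (free_star ?tf * free_star ?tf) * (w * q2_S) = q2_emb (?tf * ?tf) * (q2_S * w)"
    by (simp add: q2_emb_simps t)
  let ?h = "\<lambda>y. q2_column y w y"
  have cocycle: "(cnj (1 - y / 2))\<^sup>2 * ?h y = (1 - y / 2)\<^sup>2 * ?h (y\<^sup>2)" if "cmod y = 1" for y
  proof (rule diagonal_cocycle [OF wU that eq])
    show "act (free_star ?tf * free_star ?tf) f z = (cnj (1 - z / 2))\<^sup>2 * f z"
      "act (?tf * ?tf) f z = (1 - z / 2)\<^sup>2 * f z" for f z
      by (simp_all add: act_mult act_one_minus_half_U act_star_one_minus_half_U power2_eq_square)
  qed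
  obtain \<zeta> :: complex where \<zeta>: "cmod \<zeta> = 1" "\<zeta> ^ 8 = \<zeta>"
    and ne: "((1 - \<zeta> / 2) * (1 - \<zeta>\<^sup>2 / 2) * (1 - \<zeta> ^ 4 / 2))\<^sup>2
      \<noteq> (cnj ((1 - \<zeta> / 2) * (1 - \<zeta>\<^sup>2 / 2) * (1 - \<zeta> ^ 4 / 2)))\<^sup>2" (is "?F\<^sup>2 \<noteq> _")
    by (rule seventh_root_of_unity_product)
  have norm: "cmod (\<zeta> ^ k) = 1" for k
    by (simp add: norm_power \<zeta>)
  let ?H = "?h \<zeta> * ?h (\<zeta>\<^sup>2) * ?h (\<zeta> ^ 4)"
  have H: "?H \<noteq> 0"
    using column_diagonal_nonzero [OF wU w] norm \<zeta>(1) by simp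
  have "(cnj ?F)\<^sup>2 * ?H = ((cnj (1 - \<zeta> / 2))\<^sup>2 * ?h \<zeta>) * ((cnj (1 - \<zeta>\<^sup>2 / 2))\<^sup>2 * ?h (\<zeta>\<^sup>2))
      * ((cnj (1 - \<zeta> ^ 4 / 2))\<^sup>2 * ?h (\<zeta> ^ 4))"
    by (simp only: complex_cnj_mult power_mult_distrib mult_ac)
  also have "\<dots> = ((1 - \<zeta> / 2)\<^sup>2 * ?h (\<zeta>\<^sup>2)) * ((1 - \<zeta>\<^sup>2 / 2)\<^sup>2 * ?h (\<zeta> ^ 4))
      * ((1 - \<zeta> ^ 4 / 2)\<^sup>2 * ?h \<zeta>)"
    using cocycle [OF \<zeta>(1)] cocycle [OF norm [of 2]] cocycle [OF norm [of 4]] \<zeta>(2)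
    by (simp only: power_mult [symmetric]) simp
  also have "\<dots> = ?F\<^sup>2 * ?H"
    by (simp only: power_mult_distrib mult_ac)
  finally show False
    using H ne by simp
qed

section \<open>Unitary phases in C*-algebras\<close>

lemma norm_isometry_le_one: "isometry_elt (u :: 'a::cstar_algebra) \<Longrightarrow> norm u \<le> 1"
proof -
  have "norm (1 :: 'a) = (norm (1 :: 'a))\<^sup>2"
    using cstar_identity [of "1 :: 'a"] by (simp add: star_one)
  then have one: "norm (1 :: 'a) \<le> 1"
    by (auto simp: power2_eq_square)
  assume "isometry_elt u"
  then have "(norm u)\<^sup>2 \<le> 1"
    using cstar_identity [of u] one by (simp add: isometry_elt_def)
  then show ?thesis
    by (simp add: power_le_one_iff)
qed

text \<open>A right inverse is a fixed point of the contraction \<open>r \<mapsto> 1 + x * r\<close>, and a left inverse is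
  obtained in the same way; by associativity the two agree.\<close>

lemma invertible_one_minus:
  fixes x :: "'a::cstar_algebra"
  assumes "norm x < 1"
  obtains r where "(1 - x) * r = 1" "r * (1 - x) = 1"
proof -
  have "\<exists>!r. 1 + x * r = r"
    by (rule banach_fix_type [of "norm x"])
      (simp_all add: assms dist_norm norm_mult_ineq flip: right_diff_distrib)
  then obtain r where "1 + x * r = r" by blast
  have "\<exists>!s. 1 + s * x = s"
  proof (rule banach_fix_type [of "norm x"])
    show "\<forall>r s. dist (1 + r * x) (1 + s * x) \<le> norm x * dist r s"
      using norm_mult_ineq [of _ x]
      by (simp add: dist_norm mult.commute [of "norm x"] flip: left_diff_distrib)
  qed (simp_all add: assms)
  then obtain s where "1 + s * x = s" by blast
  have r: "(1 - x) * r = 1" and s: "s * (1 - x) = 1"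
    using \<open>1 + x * r = r\<close> \<open>1 + s * x = s\<close> by (simp_all add: algebra_simps)
  have "s = s * ((1 - x) * r)"
    by (simp add: r)
  also have "\<dots> = r"
    by (simp add: s flip: mult.assoc)
  finally show ?thesis
    using that r s by simp
qed

text \<open>With \<open>r\<close> the inverse of \<open>star t\<close>, the element \<open>t * r\<close> is the square of the unitary part in the polar
  decomposition of \<open>t\<close>. The last two equations clear the denominators in \<open>t * r\<close> and its adjoint.\<close>

lemma normal_phase:
  fixes t r :: "'a::cstar_algebra"
  assumes normal: "t * star t = star t * t" and r: "star t * r = 1" "r * star t = 1"
  shows "unitary_elt (t * r)" "star (t * r) = star t * star r"
    "t * star t * (t * r) = t * t" "t * star t * star (t * r) = star t * star t"
proof -
  have r': "star r * t = 1" "t * star r = 1"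
    using arg_cong [OF r(1), of star] arg_cong [OF r(2), of star]
    by (simp_all add: star_mult star_star star_one)
  have c: "star t * (r * z) = z" "r * (star t * z) = z" "star r * (t * z) = z" "t * (star r * z) = z" for z
    using r r' by (simp_all flip: mult.assoc)
  have n: "t * (star t * z) = star t * (t * z)" for z
    using normal by (simp flip: mult.assoc)
  have "star r * star t = star r * (star t * (t * star r))"
    by (simp add: r')
  also have "\<dots> = star t * star r"
    by (simp add: c flip: n)
  finally have q: "star r * star t = star t * star r" .
  show v: "star (t * r) = star t * star r"
    by (simp add: star_mult q)
  have "star (t * r) * (t * r) = 1"
    unfolding v by (simp add: mult.assoc c r)
  moreover have "(t * r) * star (t * r) = 1"
    unfolding v by (simp add: mult.assoc c r')
  ultimately show "unitary_elt (t * r)"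
    by (simp add: unitary_elt_def)
  show "t * star t * (t * r) = t * t"
    using n by (simp add: mult.assoc c r flip: n)
  show "t * star t * star (t * r) = star t * star t"
    unfolding v by (simp add: mult.assoc n c r')
qed

section \<open>Automorphisms of Q2 and commutation in the outer automorphism group\<close>

lemma star_hom_simps:
  assumes "star_hom \<phi>"
  shows "\<phi> (x + y) = \<phi> x + \<phi> y" "\<phi> (x - y) = \<phi> x - \<phi> y" "\<phi> (c *\<^sub>C x) = c *\<^sub>C \<phi> x"
    "\<phi> (x * y) = \<phi> x * \<phi> y" "\<phi> (star x) = star (\<phi> x)" "\<phi> 1 = 1"
proof -
  have add: "\<phi> (x + y) = \<phi> x + \<phi> y" for x y
    using assms by (simp add: star_hom_def)
  show "\<phi> (x - y) = \<phi> x - \<phi> y"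
    using add [of "x - y" y] by simp
qed (use assms in \<open>simp_all add: star_hom_def\<close>)

lemma Q2_hom_inverse:
  assumes \<phi>: "star_hom \<phi>" "continuous_on UNIV \<phi>" and \<psi>: "star_hom \<psi>" "continuous_on UNIV \<psi>"
    and "\<phi> (\<psi> q2_U) = q2_U" "\<phi> (\<psi> q2_S) = q2_S"
  shows "\<phi> \<circ> \<psi> = (id :: Q2 \<Rightarrow> Q2)"
proof -
  have "continuous_on UNIV (\<phi> \<circ> \<psi>)"
    using continuous_on_compose [OF \<psi>(2)] continuous_on_subset [OF \<phi>(2)] by blast
  then have "star_hom (\<phi> \<circ> \<psi>) \<and> continuous_on UNIV (\<phi> \<circ> \<psi>) \<and> (\<phi> \<circ> \<psi>) q2_U = q2_U \<and> (\<phi> \<circ> \<psi>) q2_S = q2_S"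
    using assms by (simp add: star_hom_comp)
  moreover have "star_hom id \<and> continuous_on UNIV id \<and> id q2_U = q2_U \<and> id q2_S = q2_S"
    by (simp add: star_hom_id)
  ultimately show ?thesis
    using ex1E [OF Q2_universal [OF q2_relations_q2]] by metis
qed

lemma comm_Out_imp_commute_up_to_inner:
  fixes \<phi> \<psi> :: "'a::cstar_algebra \<Rightarrow> 'a"
  assumes comm: "comm_group (Out :: ('a \<Rightarrow> 'a) set monoid)"
    and \<phi>: "\<phi> \<in> carrier Aut" and \<psi>: "\<psi> \<in> carrier Aut"
  obtains w where "unitary_elt w" "\<And>x. \<phi> (\<psi> x) = w * \<psi> (\<phi> x) * star w"
proof -
  interpret N: normal Inn "Aut :: ('a \<Rightarrow> 'a) monoid"
    by (rule normal_Inn)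
  interpret O: comm_group "Out :: ('a \<Rightarrow> 'a) set monoid"
    by (rule comm)
  let ?c = "\<lambda>\<phi>. Inn #>\<^bsub>Aut\<^esub> \<phi>"
  have "?c \<phi> \<in> carrier Out" "?c \<psi> \<in> carrier Out"
    using \<phi> \<psi> by (auto simp: Out_def FactGroup_def RCOSETS_def)
  then have "?c \<phi> \<otimes>\<^bsub>Out\<^esub> ?c \<psi> = ?c \<psi> \<otimes>\<^bsub>Out\<^esub> ?c \<phi>"
    by (rule O.m_comm)
  then have "?c (\<phi> \<otimes>\<^bsub>Aut\<^esub> \<psi>) = ?c (\<psi> \<otimes>\<^bsub>Aut\<^esub> \<phi>)"
    using \<phi> \<psi> by (simp add: Out_def FactGroup_def N.rcos_sum)
  moreover have "\<phi> \<otimes>\<^bsub>Aut\<^esub> \<psi> \<in> ?c (\<phi> \<otimes>\<^bsub>Aut\<^esub> \<psi>)"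
    using \<phi> \<psi> by (intro N.rcos_self N.is_subgroup) auto
  ultimately obtain h where "h \<in> Inn" "\<phi> \<circ> \<psi> = h \<circ> (\<psi> \<circ> \<phi>)"
    by (auto simp: r_coset_def Aut_def)
  then show ?thesis
    using that by (auto simp: Inn_def fun_eq_iff)
qed

lemma Q2_hom_exists:
  assumes "q2_relations u (s :: Q2)"
  obtains \<phi> where "star_hom \<phi>" "continuous_on UNIV \<phi>" "\<phi> q2_U = u" "\<phi> q2_S = s"
  using Q2_universal [OF assms] by blast

text \<open>The relation \<open>S U\<^sup>* = (U\<^sup>*)\<^sup>2 S\<close> follows by multiplying \<open>S U = U\<^sup>2 S\<close> by inverses of \<open>U\<close> on both
  sides; conjugating the range relation by \<open>U\<^sup>*\<close> interchanges its two summands.\<close>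

lemma q2_relations_flip:
  assumes "q2_relations u s"
  shows "q2_relations (star u) s"
proof -
  have u: "star u * u = 1" "u * star u = 1" and su: "s * u = u * u * s"
    and sum: "s * star s + u * s * star s * star u = 1" and s: "isometry_elt s"
    using assms by (auto simp: q2_relations_def unitary_elt_def power2_eq_square)
  have c: "star u * (u * z) = z" "u * (star u * z) = z" for z
    using u by (simp_all flip: mult.assoc)
  have "s * star u = star u * star u * (u * u * s) * star u"
    by (simp add: mult.assoc c)
  also have "\<dots> = star u * star u * (s * u) * star u"
    by (simp only: su)
  also have "\<dots> = star u * star u * s"
    by (simp add: mult.assoc u)
  finally have "s * star u = star u * star u * s" .
  moreover have "s * star s + star u * s * star s * u = 1"
  proof -
    have "star u * (s * star s + u * s * star s * star u) * u = 1"
      unfolding sum by (simp add: u)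
    then show ?thesis
      by (simp add: distrib_left distrib_right mult.assoc c u add.commute)
  qed
  ultimately show ?thesis
    using s u by (simp add: q2_relations_def unitary_elt_def star_star power2_eq_square)
qed

lemma q2_relations_phase:
  assumes rel: "q2_relations u s" and v: "unitary_elt v" and comm: "v * u = u * v"
  shows "q2_relations u (v * s)"
proof -
  have u: "unitary_elt u" and s: "star s * s = 1" and su: "s * u = u * u * s"
    and sum: "s * star s + u * s * star s * star u = 1"
    using rel by (auto simp: q2_relations_def isometry_elt_def power2_eq_square)
  have v': "star v * v = 1" "v * star v = 1"
    using v by (auto simp: unitary_elt_def)
  have c: "star v * (v * z) = z" for z
    using v' by (simp flip: mult.assoc)
  have comm': "u * (v * z) = v * (u * z)" for z
    using comm by (simp flip: mult.assoc)
  have comm_star: "star v * star u = star u * star v"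
    using arg_cong [OF comm, of star] by (simp add: star_mult)
  have "v * s * (star s * star v) + u * (v * s) * (star s * star v) * star u
      = v * (s * star s + u * s * star s * star u) * star v"
    by (simp add: distrib_left distrib_right mult.assoc comm' comm_star)
  also have "\<dots> = 1"
    by (simp add: sum v')
  finally show ?thesis
    using u by (simp add: q2_relations_def isometry_elt_def star_mult mult.assoc c s su comm'
        power2_eq_square)
qed

section \<open>The outer automorphism group of Q2 is not abelian\<close>

theorem theorem6p9:
  shows "\<not> comm_group (Out :: (Q2 \<Rightarrow> Q2) set monoid)"
proof
  assume abelian: "comm_group (Out :: (Q2 \<Rightarrow> Q2) set monoid)"
  note rel = q2_relations_q2
  have U: "star q2_U * q2_U = 1" "q2_U * star q2_U = 1" "unitary_elt q2_U"
    using rel by (auto simp: q2_relations_def unitary_elt_def)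
  define t where "t = q2_emb one_minus_half_U"
  have t_def': "t = 1 - (1 / 2) *\<^sub>C q2_U"
    by (simp add: t_def one_minus_half_U_def q2_U_def q2_emb_simps)
  have "star t = q2_emb (free_star one_minus_half_U)"
    by (simp add: t_def q2_emb_simps(5))
  then have t_star: "star t = 1 - (1 / 2) *\<^sub>C star q2_U"
    by (simp add: one_minus_half_U_def q2_U_def q2_emb_simps free_star_diff free_scale_star)
  have comm_t: "t * x = x * t" if "x * q2_U = q2_U * x" for x
    using that by (simp add: t_def' left_diff_distrib right_diff_distrib mult_scaleC_left mult_scaleC_right)
  have normal: "t * star t = star t * t"
    by (rule comm_t)
      (simp add: t_star left_diff_distrib right_diff_distrib mult_scaleC_left mult_scaleC_right U)
  have comm_t_star: "star t * x = x * star t" if "x * star q2_U = star q2_U * x" for x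
    using that by (simp add: t_star left_diff_distrib right_diff_distrib mult_scaleC_left mult_scaleC_right)
  have "norm ((1 / 2) *\<^sub>C star q2_U) < 1"
    using norm_isometry_le_one [of "star q2_U"] U by (simp add: norm_scaleC isometry_elt_def star_star)
  then obtain r where r: "star t * r = 1" "r * star t = 1"
    using invertible_one_minus unfolding t_star by metis
  have inverse_unique: "x = r" if "x * star t = 1" for x
    using that r by (metis mult.assoc mult_1_left mult_1_right)
  (* v is f(U) for the function f(z) = (1 - z / 2) / (1 - cnj z / 2) *)
  define v where "v = t * r"
  note phase = normal_phase [OF normal r, folded v_def]
  have "r * q2_U = q2_U * r"
  proof -
    have "r * q2_U = r * (q2_U * star t) * r"
      by (simp add: mult.assoc r)
    also have "q2_U * star t = star t * q2_U"
      by (rule comm_t_star [symmetric]) (simp add: U)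
    also have "r * (star t * q2_U) * r = q2_U * r"
      by (simp add: r flip: mult.assoc)
    finally show ?thesis .
  qed
  then have vU: "v * q2_U = q2_U * v"
    unfolding v_def using comm_t [of q2_U] by (metis mult.assoc)
  have svU: "star v * q2_U = q2_U * star v"
  proof -
    have "star v * q2_U = star v * (q2_U * v) * star v"
      using phase(1) by (simp add: unitary_elt_def mult.assoc)
    also have "\<dots> = star v * (v * q2_U) * star v"
      by (simp only: vU)
    also have "\<dots> = q2_U * star v"
      using phase(1) by (simp add: unitary_elt_def flip: mult.assoc)
    finally show ?thesis .
  qed
  (* This is why the maps for v and for star v are inverse to each other. *)
  have fix_v: "\<phi> v = v" if \<phi>: "star_hom \<phi>" "\<phi> q2_U = q2_U" for \<phi>
  proof -
    note \<phi>_simps = star_hom_simps [OF \<phi>(1)]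
    have "\<phi> t = t" "\<phi> (star t) = star t"
      by (simp_all only: t_star) (simp_all add: t_def' \<phi>_simps \<phi>(2))
    moreover from this have "\<phi> r = r"
      using arg_cong [OF r(2), of \<phi>] by (intro inverse_unique) (simp add: \<phi>_simps)
    ultimately show ?thesis
      by (simp add: v_def \<phi>_simps)
  qed
  obtain \<beta> where \<beta>: "star_hom \<beta>" "continuous_on UNIV \<beta>" "\<beta> q2_U = q2_U" "\<beta> q2_S = v * q2_S"
    by (rule Q2_hom_exists [OF q2_relations_phase [OF rel phase(1) vU]])
  obtain \<beta>' where \<beta>': "star_hom \<beta>'" "continuous_on UNIV \<beta>'" "\<beta>' q2_U = q2_U" "\<beta>' q2_S = star v * q2_S"
    by (rule Q2_hom_exists [OF q2_relations_phase [OF rel unitary_elt_star [OF phase(1)] svU]])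
  obtain \<kappa> where lam: "star_hom \<kappa>" "continuous_on UNIV \<kappa>" "\<kappa> q2_U = star q2_U" "\<kappa> q2_S = q2_S"
    by (rule Q2_hom_exists [OF q2_relations_flip [OF rel]])
  note \<beta>_simps = star_hom_simps [OF \<beta>(1)] and \<beta>'_simps = star_hom_simps [OF \<beta>'(1)]
    and lam_simps = star_hom_simps [OF lam(1)]
  have "\<beta> \<circ> \<beta>' = id" "\<beta>' \<circ> \<beta> = id"
    using phase(1)
    by (auto intro!: Q2_hom_inverse simp: \<beta> \<beta>' \<beta>_simps \<beta>'_simps fix_v unitary_elt_def simp flip: mult.assoc)
  then have \<beta>_Aut: "\<beta> \<in> carrier Aut"
    using \<beta>(1) by (auto simp: Aut_def intro: o_bij)
  have "\<kappa> \<circ> \<kappa> = id"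
    by (rule Q2_hom_inverse) (simp_all add: lam lam_simps star_star)
  then have lam_Aut: "\<kappa> \<in> carrier Aut"
    using lam(1) by (auto simp: Aut_def intro: o_bij)
  obtain w where w: "unitary_elt w" "\<And>x. \<beta> (\<kappa> x) = w * \<kappa> (\<beta> x) * star w"
    by (rule comm_Out_imp_commute_up_to_inner [OF abelian \<beta>_Aut lam_Aut]) blast
  have ww: "star w * w = 1" "w * star w = 1"
    using w(1) by (auto simp: unitary_elt_def)
  (* Both composites map q2_U to its adjoint, hence w commutes with it. *)
  have wU': "w * star q2_U = star q2_U * w"
  proof -
    have "star q2_U = w * star q2_U * star w"
      using w(2) [of q2_U] by (simp add: \<beta> \<beta>_simps lam)
    then have "star q2_U * w = w * star q2_U * star w * w"
      by simp
    then show ?thesis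
      by (simp add: mult.assoc ww)
  qed
  have wU: "w * q2_U = q2_U * w"
  proof -
    have "w * q2_U = q2_U * (star q2_U * w) * q2_U"
      by (simp add: U flip: mult.assoc)
    also have "\<dots> = q2_U * (w * star q2_U) * q2_U"
      by (simp only: wU')
    also have "\<dots> = q2_U * w"
      by (simp add: mult.assoc U)
    finally show ?thesis .
  qed
  (* f has real coefficients, so that f(cnj z) = cnj (f z) *)
  have lam_v: "\<kappa> v = star v"
  proof -
    have "\<kappa> t = star t" "\<kappa> (star t) = t"
      by (simp_all only: t_star) (simp_all add: t_def' lam_simps lam(3) star_star)
    moreover from this have "star (\<kappa> r) * star t = 1"
      using arg_cong [OF r(1), of "\<lambda>x. star (\<kappa> x)"] by (simp add: lam_simps star_mult star_one)
    then have "\<kappa> r = star r"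
      using inverse_unique star_star by metis
    ultimately show ?thesis
      unfolding phase(2) by (simp add: v_def lam_simps)
  qed
  have vS: "v * q2_S * w = w * star v * q2_S"
  proof -
    have "v * q2_S = w * (star v * q2_S) * star w"
      using w(2) [of q2_S] by (simp add: \<beta> lam lam_simps lam_v)
    then have "v * q2_S * w = w * (star v * q2_S) * star w * w"
      by simp
    then show ?thesis
      by (simp add: mult.assoc ww)
  qed
  have "t * t * (q2_S * w) = star t * star t * (w * q2_S)"
  proof -
    have cw: "t * (w * z) = w * (t * z)" "star t * (w * z) = w * (star t * z)" for z
      using comm_t [OF wU] comm_t_star [OF wU'] by (simp_all flip: mult.assoc)
    have "t * t * (q2_S * w) = t * star t * (v * q2_S * w)"
      by (simp only: phase(3)[symmetric] mult.assoc)
    also have "\<dots> = t * star t * (w * star v * q2_S)"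
      by (simp only: vS)
    also have "\<dots> = w * (t * star t * star v) * q2_S"
      by (simp only: mult.assoc cw)
    also have "\<dots> = star t * star t * (w * q2_S)"
      by (simp only: phase(4)) (simp only: mult.assoc cw)
    finally show ?thesis .
  qed
  with no_diagonal_intertwiner [OF w(1) wU t_def] show False
    by contradiction
qed

end
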